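(* Let $k\ge 2$ and let $T$ be a $k$-uniform hypertree on $n$ vertices, where $\frac{n-1}{k-1}\ge 1$. Then $\rho(T)\le\rho(P_{n,k})$, with equality if and only if $T\cong P_{n,k}$.
   Context: All hypergraphs are finite. A hypergraph $G$ consists of a nonempty vertex set $V(G)$ and an edge set $E(G)$ whose elements are nonempty subsets of $V(G)$. It is $k$-uniform ($k\ge 2$) if every edge has exactly $k$ vertices. A walk of length $p$ from $u$ to $v$ is a sequence $(v_0,e_1,v_1,\dots,v_{p-1},e_p,v_p)$ with $v_0=u$, $v_p=v$, each $e_i$ an edge containing $v_{i-1}$ and $v_i$, and $v_{i-1}\ne v_i$. A path is a walk with all $v_i$ distinct and all $e_i$ distinct; a single vertex is a path of length $0$. A cycle is a walk with at least two edges in which all $e_i$ are distinct and all $v_i$ are distinct except that the first and last vertices coincide. $G$ is connected if there is a path between any two vertices. A hypertree is a connected hypergraph with no cycles; a $k$-uniform hypertree with $m$ edges has order $n=1+(k-1)m$. For connected $G$, the distance $d_G(u,v)$ is the length of a shortest path from $u$ to $v$ (with $d_G(u,u)=0$), the distance matrix is $D(G)=(d_G(u,v))_{u,v\in V(G)}$, and the distance spectral radius $\rho(G)$ is the largest eigenvalue of $D(G)$. The $k$-uniform loose path $P_{n,k}$ of order $n=1+(k-1)m$ has vertices $v_1,\dots,v_n$ and edges $e_1,\dots,e_m$ with $e_i=\{v_{(i-1)(k-1)+1},\dots,v_{(i-1)(k-1)+k}\}$ for $i=1,\dots,m$. *)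

theory Defs
  imports "Jordan_Normal_Form.Spectral_Radius"
begin

record 'a hypergraph =
  verts :: "'a set"
  edges :: "'a set set"

definition hypergraph :: "'a hypergraph \<Rightarrow> bool" where
  "hypergraph G \<longleftrightarrow> finite (verts G) \<and> verts G \<noteq> {} \<and>
     (\<forall>e\<in>edges G. e \<noteq> {} \<and> e \<subseteq> verts G)"

definition uniform :: "nat \<Rightarrow> 'a hypergraph \<Rightarrow> bool" where
  "uniform k G \<longleftrightarrow> (\<forall>e\<in>edges G. card e = k)"

text \<open>A walk $(v_0,e_1,v_1,\dots,e_p,v_p)$ is given by its vertex list $[v_0,\dots,v_p]$ and its
  edge list $[e_1,\dots,e_p]$, so that its length is the length of the edge list, and the edge
  with list index \<open>i\<close> joins the vertices with list indices \<open>i\<close> and \<open>Suc i\<close>.\<close>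

definition walk :: "'a hypergraph \<Rightarrow> 'a list \<Rightarrow> 'a set list \<Rightarrow> bool" where
  "walk G vs es \<longleftrightarrow> length vs = Suc (length es) \<and> set vs \<subseteq> verts G \<and> set es \<subseteq> edges G \<and>
     (\<forall>i<length es. vs ! i \<in> es ! i \<and> vs ! Suc i \<in> es ! i \<and> vs ! i \<noteq> vs ! Suc i)"

definition path_between :: "'a hypergraph \<Rightarrow> 'a \<Rightarrow> 'a \<Rightarrow> 'a list \<Rightarrow> 'a set list \<Rightarrow> bool" where
  "path_between G u v vs es \<longleftrightarrow>
     walk G vs es \<and> hd vs = u \<and> last vs = v \<and> distinct vs \<and> distinct es"

definition hcycle :: "'a hypergraph \<Rightarrow> 'a list \<Rightarrow> 'a set list \<Rightarrow> bool" where
  "hcycle G vs es \<longleftrightarrow>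
     walk G vs es \<and> length es \<ge> 2 \<and> distinct es \<and> hd vs = last vs \<and> distinct (tl vs)"

definition hconnected :: "'a hypergraph \<Rightarrow> bool" where
  "hconnected G \<longleftrightarrow> (\<forall>u\<in>verts G. \<forall>v\<in>verts G. \<exists>vs es. path_between G u v vs es)"

definition hypertree :: "'a hypergraph \<Rightarrow> bool" where
  "hypertree G \<longleftrightarrow> hypergraph G \<and> hconnected G \<and> (\<nexists>vs es. hcycle G vs es)"

text \<open>Meaningful only if some path joins \<open>u\<close> and \<open>v\<close>.\<close>

definition hdist :: "'a hypergraph \<Rightarrow> 'a \<Rightarrow> 'a \<Rightarrow> nat" where
  "hdist G u v = (LEAST p. \<exists>vs es. path_between G u v vs es \<and> length es = p)"

text \<open>The matrices of the library are indexed by initial segments of the naturals, so the vertices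
  are enumerated by a list. Another enumeration conjugates the matrix by a permutation matrix, which
  does not change its eigenvalues; hence the choice made in \<open>dist_spectral_radius\<close> is immaterial.\<close>

definition distance_matrix :: "'a hypergraph \<Rightarrow> 'a list \<Rightarrow> real mat" where
  "distance_matrix G xs =
     mat (length xs) (length xs) (\<lambda>(i, j). real (hdist G (xs ! i) (xs ! j)))"

text \<open>The library's \<open>spectral_radius\<close> is the largest modulus of an eigenvalue of a complex matrix;
  here the largest eigenvalue itself is meant. All eigenvalues are real by symmetry, so taking the
  spectrum over the reals loses none.\<close>

definition dist_spectral_radius :: "'a hypergraph \<Rightarrow> real" where
  "dist_spectral_radius G =
     Max (spectrum (distance_matrix G (SOME xs. distinct xs \<and> set xs = verts G)))"

definition isomorphic :: "'a hypergraph \<Rightarrow> 'b hypergraph \<Rightarrow> bool" where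
  "isomorphic G H \<longleftrightarrow>
     (\<exists>f. bij_betw f (verts G) (verts H) \<and> (\<lambda>e. f ` e) ` edges G = edges H)"

text \<open>Intended for \<open>n = 1 + (k - 1) * m\<close>, where \<open>(n - 1) div (k - 1)\<close> is the number \<open>m\<close> of edges.\<close>

definition loose_path :: "nat \<Rightarrow> nat \<Rightarrow> nat hypergraph" where
  "loose_path n k =
     \<lparr>verts = {1..n},
      edges = (\<lambda>i. {(i - 1) * (k - 1) + 1 .. (i - 1) * (k - 1) + k}) ` {1..(n - 1) div (k - 1)}\<rparr>"

end

theory Submission
  imports Defs "HOL-Analysis.Function_Topology"
begin

text \<open>On the finite set of \<open>k\<close>-uniform hypertrees with a given vertex set, let \<open>G\<close> maximise the
  distance spectral radius, and let \<open>x > 0\<close> be its Perron vector. Let \<open>f\<close> be an edge at \<open>u\<close> and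
  \<open>B\<close> the component of \<open>u\<close> after removal of \<open>f\<close>. Replacing \<open>u\<close> in \<open>f\<close> by some \<open>a \<in> B\<close> yields
  another hypertree, and changes the quadratic form of the distance matrix at \<open>x\<close> by a positive multiple of
  \<open>\<sigma> a - \<sigma> u\<close>, where \<open>\<sigma> w = (\<Sum>y\<in>B. x y * d w y)\<close>. By maximality \<open>\<sigma> a \<le> \<sigma> u\<close>.

  If \<open>u\<close> lay in three edges \<open>f, g, h\<close>, strict convexity of \<open>\<sigma>\<close> along a path from \<open>g\<close> through \<open>u\<close> to
  \<open>h\<close> would contradict this. If an edge \<open>e\<close> had three vertices \<open>u1, u2, u3\<close> lying in further
  edges, and the branch of \<open>e\<close> at \<open>u1\<close> weighs at least as much as the one at \<open>u2\<close>, move an edge at \<open>u3\<close> to a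
  vertex \<open>a\<close> of the branch at \<open>u2\<close> whose distance \<open>p\<close> from \<open>u2\<close> is maximal. Then \<open>\<sigma> a \<le> \<sigma> u3\<close> forces
  \<open>x a \<ge> (p + 1) * x u3 + (2 * p - 1) * x u2\<close>, which a comparison of the rows \<open>a\<close>, \<open>u3\<close> and \<open>u2\<close>
  of the eigenvalue equation refutes. So the edges of \<open>G\<close> are arranged linearly.\<close>

section \<open>The largest eigenvalue of a symmetric matrix\<close>

definition qform :: "'a set \<Rightarrow> ('a \<Rightarrow> 'a \<Rightarrow> real) \<Rightarrow> ('a \<Rightarrow> real) \<Rightarrow> real" where
  "qform V d x = (\<Sum>u\<in>V. \<Sum>v\<in>V. d u v * x u * x v)"

lemma qform_cong:
  assumes "\<And>u v. u \<in> V \<Longrightarrow> v \<in> V \<Longrightarrow> d u v = d' u v" "\<And>u. u \<in> V \<Longrightarrow> x u = x' u"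
  shows "qform V d x = qform V d' x'"
  unfolding qform_def using assms by (intro sum.cong) auto

lemma qform_scale: "qform V d (\<lambda>u. c * x u) = c\<^sup>2 * qform V d x"
  unfolding qform_def sum_distrib_left by (simp add: power2_eq_square mult_ac)

lemma qform_bij_betw:
  assumes "bij_betw f V W" "\<And>u v. u \<in> V \<Longrightarrow> v \<in> V \<Longrightarrow> d' (f u) (f v) = d u v"
  shows "qform W d' x = qform V d (x \<circ> f)"
  unfolding qform_def using assms(2)
  by (simp add: sum.reindex_bij_betw[OF assms(1), symmetric])

text \<open>The unit sphere is compact and the form is continuous. The sphere is realised inside the
  functions vanishing off \<open>V\<close>, so that Tychonoff's theorem gives compactness on any
  type; homogeneity extends the bound to every \<open>y\<close>.\<close>

lemma ex_rayleigh_max: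
  fixes d :: "'a \<Rightarrow> 'a \<Rightarrow> real"
  assumes "finite V" "V \<noteq> {}"
  shows "\<exists>x. (\<Sum>v\<in>V. (x v)\<^sup>2) = 1 \<and> (\<forall>y. qform V d y \<le> qform V d x * (\<Sum>v\<in>V. (y v)\<^sup>2))"
proof -
  let ?S = "\<lambda>i. if i \<in> V then {-1..1} else {0::real}"
  let ?N = "\<lambda>x. \<Sum>v\<in>V. (x v)\<^sup>2 :: real"
  define K where "K = Pi\<^sub>E UNIV ?S \<inter> ?N -` {1}"
  have coord: "continuous_on A (\<lambda>x::'a \<Rightarrow> real. x i)" for A i
    by (rule continuous_on_subset[OF continuous_on_product_coordinates]) simp
  have "compactin (product_topology (\<lambda>i. euclidean) UNIV) (Pi\<^sub>E UNIV ?S)"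
    unfolding compactin_PiE by auto
  then have "compact (Pi\<^sub>E UNIV ?S)"
    by (simp add: euclidean_product_topology)
  moreover have "closed (?N -` {1})"
  proof -
    have "continuous_on UNIV ?N"
      by (intro continuous_intros coord)
    then show ?thesis
      by (rule closed_vimage[OF closed_singleton])
  qed
  ultimately have K: "compact K"
    unfolding K_def by (rule compact_Int_closed)
  have norm: "(\<lambda>i. if i \<in> V then y i / sqrt (?N y) else 0) \<in> K" if "?N y \<noteq> 0" for y
  proof -
    have pos: "?N y > 0"
      using that sum_nonneg[of V "\<lambda>v. (y v)\<^sup>2"] by fastforce
    have "\<bar>y i\<bar> \<le> sqrt (?N y)" if "i \<in> V" for i
      using member_le_sum[OF that, of "\<lambda>v. (y v)\<^sup>2"] assms(1)
      by (intro real_le_rsqrt) auto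
    then have "y i / sqrt (?N y) \<in> {-1..1}" if "i \<in> V" for i
      using pos that by (force simp: field_simps abs_le_iff)
    moreover have "(\<Sum>v\<in>V. (y v / sqrt (?N y))\<^sup>2) = 1"
      using pos by (simp add: power_divide flip: sum_divide_distrib)
    ultimately show ?thesis
      by (auto simp: K_def PiE_def Pi_def)
  qed
  obtain v0 where "v0 \<in> V" using assms by auto
  then have "?N (\<lambda>i. 1) \<noteq> 0" using assms by auto
  from norm[OF this] have "K \<noteq> {}" by auto
  moreover have "continuous_on K (qform V d)"
    unfolding qform_def[abs_def] by (intro continuous_intros coord)
  ultimately obtain x where x: "x \<in> K" "\<And>y. y \<in> K \<Longrightarrow> qform V d y \<le> qform V d x"
    using continuous_attains_sup[OF K] by blast
  have "qform V d y \<le> qform V d x * ?N y" for y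
  proof (cases "?N y = 0")
    case True
    then have "\<forall>v\<in>V. y v = 0" using assms by (simp add: sum_nonneg_eq_0_iff)
    then have "qform V d y = 0" by (simp add: qform_def)
    then show ?thesis using True by simp
  next
    case False
    have pos: "?N y > 0"
      using False sum_nonneg[of V "\<lambda>v. (y v)\<^sup>2"] by fastforce
    have "qform V d (\<lambda>i. if i \<in> V then y i / sqrt (?N y) else 0) = qform V d (\<lambda>i. (1 / sqrt (?N y)) * y i)"
      by (rule qform_cong) auto
    also have "\<dots> = qform V d y / ?N y"
      using pos by (simp only: qform_scale) (simp add: power_divide)
    finally show ?thesis
      using x(2)[OF norm[OF False]] pos by (simp add: pos_divide_le_eq)
  qed
  with x(1) show ?thesis by (auto simp: K_def)
qed

lemma quadratic_nonpos_imp_linear_zero: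
  fixes b c :: real
  assumes "\<And>t. 2 * t * c + t\<^sup>2 * b \<le> 0"
  shows "c = 0"
proof (rule ccontr)
  assume "c \<noteq> 0"
  \<comment> \<open>Small enough for the linear term to dominate at \<open>t = s * c\<close>, where
    the quadratic has the value \<open>s * c\<^sup>2 * (2 + s * b)\<close>.\<close>
  define s where "s = 1 / (1 + \<bar>b\<bar>)"
  have s: "s > 0" "s * \<bar>b\<bar> < 1" by (auto simp: s_def field_simps)
  have "2 * (s * c) * c + (s * c)\<^sup>2 * b = s * c\<^sup>2 * (2 + s * b)"
    by (simp add: power2_eq_square algebra_simps)
  moreover have "s * b \<ge> - (s * \<bar>b\<bar>)"
    using s(1) by (simp add: abs_if)
  then have "2 + s * b > 0" using s by linarith
  then have "s * c\<^sup>2 * (2 + s * b) > 0" using s \<open>c \<noteq> 0\<close> by simp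
  ultimately show False using assms[of "s * c"] by linarith
qed

text \<open>First variation: changing \<open>x\<close> by \<open>t\<close> in the coordinate
  \<open>u\<close> alone alters the form minus \<open>l\<close> times the squared norm by a
  quadratic in \<open>t\<close>, whose linear coefficient is twice the defect of the eigenvalue
  equation at \<open>u\<close>.\<close>

lemma rayleigh_max_eigenvector:
  assumes fin: "finite V" and sym: "\<And>u v. u \<in> V \<Longrightarrow> v \<in> V \<Longrightarrow> d u v = d v u"
    and max: "\<And>y. qform V d y \<le> l * (\<Sum>v\<in>V. (y v)\<^sup>2)"
    and x: "qform V d x = l * (\<Sum>v\<in>V. (x v)\<^sup>2)" and u: "u \<in> V"
  shows "(\<Sum>v\<in>V. d u v * x v) = l * x u"
proof -
  let ?c = "(\<Sum>v\<in>V. d u v * x v)"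
  define \<delta> where "\<delta> = (\<lambda>v. if v = u then 1 else 0 :: real)"
  have d1: "(\<Sum>v\<in>V. \<delta> v * g v) = g u" for g :: "'a \<Rightarrow> real"
  proof -
    have "(\<Sum>v\<in>V. \<delta> v * g v) = (\<Sum>v\<in>V. if v = u then g v else 0)"
      by (intro sum.cong) (auto simp: \<delta>_def)
    then show ?thesis using u fin by (simp add: sum.delta)
  qed
  have "2 * t * (?c - l * x u) + t\<^sup>2 * (d u u - l) \<le> 0" for t
  proof -
    have "qform V d (\<lambda>v. x v + t * \<delta> v) =
       (\<Sum>a\<in>V. \<Sum>b\<in>V. d a b * x a * x b + t * (\<delta> a * (d a b * x b)) + t * (\<delta> b * (d a b * x a))
          + t\<^sup>2 * (\<delta> a * (\<delta> b * d a b)))"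
      unfolding qform_def by (intro sum.cong refl) (simp add: power2_eq_square algebra_simps)
    also have "\<dots> = qform V d x + t * ?c + t * (\<Sum>a\<in>V. d a u * x a) + t\<^sup>2 * d u u"
      by (simp add: sum.distrib qform_def d1 flip: sum_distrib_left)
    also have "(\<Sum>a\<in>V. d a u * x a) = ?c"
      using sym u by (intro sum.cong) auto
    finally have 1: "qform V d (\<lambda>v. x v + t * \<delta> v) = qform V d x + 2 * t * ?c + t\<^sup>2 * d u u"
      by simp
    have "(\<Sum>v\<in>V. (x v + t * \<delta> v)\<^sup>2) =
        (\<Sum>v\<in>V. (x v)\<^sup>2 + 2 * t * (\<delta> v * x v) + t\<^sup>2 * (\<delta> v * \<delta> v))"
      by (intro sum.cong refl) (simp add: power2_eq_square algebra_simps)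
    also have "\<dots> = (\<Sum>v\<in>V. (x v)\<^sup>2) + 2 * t * x u + t\<^sup>2 * \<delta> u"
      by (simp add: sum.distrib d1 flip: sum_distrib_left)
    finally have 2: "(\<Sum>v\<in>V. (x v + t * \<delta> v)\<^sup>2) = (\<Sum>v\<in>V. (x v)\<^sup>2) + 2 * t * x u + t\<^sup>2"
      by (simp add: \<delta>_def)
    show ?thesis
      using max[of "\<lambda>v. x v + t * \<delta> v"] unfolding 1 2 x by (simp add: algebra_simps)
  qed
  from quadratic_nonpos_imp_linear_zero[OF this] show ?thesis by simp
qed

text \<open>Absolute values do not lower the form, as the entries are nonnegative, so they turn a
  maximiser into a nonnegative eigenvector. A zero at \<open>u\<close> would, by row
  \<open>u\<close> and the positive off-diagonal entries, make the whole vector zero.\<close>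

lemma ex_perron_vector:
  fixes d :: "'a \<Rightarrow> 'a \<Rightarrow> real"
  assumes fin: "finite V" and card: "card V \<ge> 2"
    and sym: "\<And>u v. u \<in> V \<Longrightarrow> v \<in> V \<Longrightarrow> d u v = d v u"
    and diag: "\<And>u. u \<in> V \<Longrightarrow> d u u = 0"
    and pos: "\<And>u v. u \<in> V \<Longrightarrow> v \<in> V \<Longrightarrow> u \<noteq> v \<Longrightarrow> d u v > 0"
  shows "\<exists>x l. (\<forall>u\<in>V. x u > 0) \<and> (\<forall>u\<in>V. (\<Sum>v\<in>V. d u v * x v) = l * x u) \<and>
     (\<forall>y. qform V d y \<le> l * (\<Sum>v\<in>V. (y v)\<^sup>2))"
proof -
  have "V \<noteq> {}" using card by auto
  from ex_rayleigh_max[OF fin this, of d] obtain z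
    where z: "(\<Sum>v\<in>V. (z v)\<^sup>2) = 1" "\<And>y. qform V d y \<le> qform V d z * (\<Sum>v\<in>V. (y v)\<^sup>2)"
    by blast
  define l where "l = qform V d z"
  define x where "x = (\<lambda>v. \<bar>z v\<bar>)"
  have x1: "(\<Sum>v\<in>V. (x v)\<^sup>2) = 1" using z by (simp add: x_def)
  have nn: "d u v \<ge> 0" if "u \<in> V" "v \<in> V" for u v
    using diag pos that by (cases "u = v") (auto intro: less_imp_le)
  have "l \<le> qform V d x"
    unfolding l_def qform_def x_def
  proof (intro sum_mono)
    fix u v assume uv: "u \<in> V" "v \<in> V"
    have "d u v * z u * z v \<le> \<bar>d u v * z u * z v\<bar>" by simp
    then show "d u v * z u * z v \<le> d u v * \<bar>z u\<bar> * \<bar>z v\<bar>"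
      using nn[OF uv] by (simp add: abs_mult)
  qed
  with z(2)[of x] x1 have "qform V d x = l * (\<Sum>v\<in>V. (x v)\<^sup>2)" by (simp add: l_def)
  then have eig: "(\<Sum>v\<in>V. d u v * x v) = l * x u" if "u \<in> V" for u
    using z(2) that by (intro rayleigh_max_eigenvector[where d = d]) (auto simp: l_def fin sym)
  have "x u > 0" if u: "u \<in> V" for u
  proof (rule ccontr)
    assume "\<not> x u > 0"
    then have "x u = 0" by (simp add: x_def)
    then have "(\<Sum>v\<in>V. d u v * x v) = 0" using eig[OF u] by simp
    then have "\<forall>v\<in>V. d u v * x v = 0"
      by (subst (asm) sum_nonneg_eq_0_iff) (use fin nn u in \<open>auto simp: x_def\<close>)
    then have "x v = 0" if "v \<in> V" for v
      using \<open>x u = 0\<close> pos[OF u that] that by (cases "v = u") fastforce+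
    then show False using x1 by simp
  qed
  with eig z(2) show ?thesis unfolding l_def by blast
qed

section \<open>From quadratic forms to the distance spectral radius\<close>

lemma dist_spectral_radius_eqI:
  fixes G :: "'a hypergraph"
  assumes fin: "finite (verts G)"
    and eig: "\<And>u. u \<in> verts G \<Longrightarrow> (\<Sum>v\<in>verts G. real (hdist G u v) * x v) = l * x u"
    and nz: "w \<in> verts G" "x w \<noteq> 0"
    and max: "\<And>y. qform (verts G) (\<lambda>u v. real (hdist G u v)) y \<le> l * (\<Sum>v\<in>verts G. (y v)\<^sup>2)"
  shows "dist_spectral_radius G = l"
proof -
  define xs where "xs = (SOME xs. distinct xs \<and> set xs = verts G)"
  have "\<exists>xs. distinct xs \<and> set xs = verts G"
    using finite_distinct_list[OF fin] by blast
  then have xs: "distinct xs" "set xs = verts G"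
    using someI_ex[of "\<lambda>xs. distinct xs \<and> set xs = verts G"] unfolding xs_def by auto
  define n where "n = length xs"
  define A where "A = distance_matrix G xs"
  have A: "A \<in> carrier_mat n n" by (simp add: A_def distance_matrix_def n_def)
  have bij: "bij_betw (\<lambda>i. xs ! i) {0..<n} (verts G)"
    using bij_betw_nth[OF xs(1), of "{0..<n}" "verts G"] xs by (auto simp: n_def atLeast0LessThan)
  have vx: "xs ! i \<in> verts G" if "i < n" for i using that xs(2) nth_mem n_def by blast
  have mult: "(A *\<^sub>v v) $ i = (\<Sum>j\<in>{0..<n}. real (hdist G (xs ! i) (xs ! j)) * v $ j)"
    if "v \<in> carrier_vec n" "i < n" for v i
    using that by (simp add: A_def distance_matrix_def n_def scalar_prod_def)
  have "eigenvalue A l"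
    unfolding eigenvalue_def eigenvector_def
  proof (intro exI conjI)
    let ?v = "vec n (\<lambda>i. x (xs ! i))"
    show "?v \<in> carrier_vec (dim_row A)" using A by simp
    obtain i where i: "i < n" "xs ! i = w"
      using nz(1) xs(2) by (metis in_set_conv_nth n_def)
    then have "?v $ i \<noteq> 0" using nz by simp
    then show "?v \<noteq> 0\<^sub>v (dim_row A)" using A i by fastforce
    show "A *\<^sub>v ?v = l \<cdot>\<^sub>v ?v"
    proof (rule eq_vecI)
      fix i assume "i < dim_vec (l \<cdot>\<^sub>v ?v)"
      then have i: "i < n" by simp
      have "(A *\<^sub>v ?v) $ i = (\<Sum>j\<in>{0..<n}. real (hdist G (xs ! i) (xs ! j)) * x (xs ! j))"
        by (subst mult) (use i in auto)
      also have "\<dots> = (\<Sum>v\<in>verts G. real (hdist G (xs ! i) v) * x v)"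
        by (rule sum.reindex_bij_betw[OF bij])
      also have "\<dots> = l * x (xs ! i)" using eig vx i by simp
      finally show "(A *\<^sub>v ?v) $ i = (l \<cdot>\<^sub>v ?v) $ i" using i by simp
    qed (use A in auto)
  qed
  \<comment> \<open>Read as a function on the vertices, an eigenvector for \<open>m\<close> has form
    value \<open>m\<close> times its squared norm, so the bound \<open>max\<close> applies.\<close>
  moreover have "m \<le> l" if "eigenvalue A m" for m
  proof -
    from that obtain v where v: "v \<in> carrier_vec n" "v \<noteq> 0\<^sub>v n" "A *\<^sub>v v = m \<cdot>\<^sub>v v"
      using A by (auto simp: eigenvalue_def eigenvector_def)
    define y where "y = (\<lambda>u. v $ (inv_into {0..<n} (\<lambda>i. xs ! i) u))"
    have y: "y (xs ! i) = v $ i" if "i < n" for i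
      using bij_betw_inv_into_left[OF bij] that by (simp add: y_def)
    have row: "(\<Sum>w\<in>verts G. real (hdist G u w) * y w) = m * y u" if u: "u \<in> verts G" for u
    proof -
      obtain i where i: "i < n" "xs ! i = u"
        using u xs(2) by (metis in_set_conv_nth n_def)
      have "(\<Sum>w\<in>verts G. real (hdist G u w) * y w) = (\<Sum>j\<in>{0..<n}. real (hdist G u (xs ! j)) * y (xs ! j))"
        by (rule sum.reindex_bij_betw[OF bij, symmetric])
      also have "\<dots> = (A *\<^sub>v v) $ i"
        by (subst mult) (use i v y in auto)
      also have "\<dots> = m * v $ i" using v i by simp
      finally show ?thesis using y i by auto
    qed
    have "qform (verts G) (\<lambda>u v. real (hdist G u v)) y
        = (\<Sum>u\<in>verts G. y u * (\<Sum>w\<in>verts G. real (hdist G u w) * y w))"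
      unfolding qform_def sum_distrib_left by (intro sum.cong refl) (simp add: mult_ac)
    also have "\<dots> = m * (\<Sum>v\<in>verts G. (y v)\<^sup>2)"
      by (simp add: row sum_distrib_left power2_eq_square mult.left_commute)
    finally have le: "m * (\<Sum>v\<in>verts G. (y v)\<^sup>2) \<le> l * (\<Sum>v\<in>verts G. (y v)\<^sup>2)"
      using max[of y] by simp
    obtain i where i: "i < n" "v $ i \<noteq> 0"
    proof (rule ccontr)
      assume "\<not> thesis"
      then have "v = 0\<^sub>v n" using v(1) that by (intro eq_vecI) auto
      with v(2) show False by simp
    qed
    then have "(\<Sum>v\<in>verts G. (y v)\<^sup>2) > 0"
      using fin vx[OF i(1)] y[OF i(1)] by (intro sum_pos2[of _ "xs ! i"]) auto
    with le show ?thesis by simp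
  qed
  ultimately show ?thesis
    unfolding dist_spectral_radius_def xs_def[symmetric] A_def[symmetric] spectrum_def
    using card_finite_spectrum(1)[OF A] by (intro Max_eqI) (auto simp: spectrum_def)
qed

lemma dist_spectral_radius_perron:
  fixes G :: "'a hypergraph"
  assumes fin: "finite (verts G)" and card: "card (verts G) \<ge> 2"
    and sym: "\<And>u v. u \<in> verts G \<Longrightarrow> v \<in> verts G \<Longrightarrow> hdist G u v = hdist G v u"
    and diag: "\<And>u v. u \<in> verts G \<Longrightarrow> v \<in> verts G \<Longrightarrow> hdist G u v = 0 \<longleftrightarrow> u = v"
  obtains x where "\<And>u. u \<in> verts G \<Longrightarrow> x u > 0"
    "\<And>u. u \<in> verts G \<Longrightarrow>
       (\<Sum>v\<in>verts G. real (hdist G u v) * x v) = dist_spectral_radius G * x u"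
    "\<And>y. qform (verts G) (\<lambda>u v. real (hdist G u v)) y
       \<le> dist_spectral_radius G * (\<Sum>v\<in>verts G. (y v)\<^sup>2)"
proof -
  from ex_perron_vector[OF fin card, of "\<lambda>u v. real (hdist G u v)"] sym diag
  obtain x l where x: "\<forall>u\<in>verts G. x u > 0"
      "\<forall>u\<in>verts G. (\<Sum>v\<in>verts G. real (hdist G u v) * x v) = l * x u"
      "\<forall>y. qform (verts G) (\<lambda>u v. real (hdist G u v)) y \<le> l * (\<Sum>v\<in>verts G. (y v)\<^sup>2)"
    by fastforce
  obtain w where w: "w \<in> verts G" using card by fastforce
  have "dist_spectral_radius G = l"
    using x w by (intro dist_spectral_radius_eqI[OF fin, where x = x and w = w]) auto
  with x show ?thesis by (intro that[of x]) auto
qed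

section \<open>Distances in hypertrees and moving an edge\<close>

text \<open>Including \<open>Id\<close> makes \<open>adj E ^^ p\<close> relate vertices joined in at
  most \<open>p\<close> steps, and lets vertex maps collapse an edge to a point.\<close>

definition adj :: "'a set set \<Rightarrow> ('a \<times> 'a) set" where
  "adj E = Id \<union> {(u, v). \<exists>e\<in>E. u \<in> e \<and> v \<in> e}"

definition conn :: "'a set set \<Rightarrow> 'a \<Rightarrow> 'a \<Rightarrow> bool" where
  "conn E u v \<longleftrightarrow> (u, v) \<in> (adj E)\<^sup>*"

text \<open>A list-free stand-in for \<open>hdist\<close>; \<open>hdist_eq_rdist\<close> identifies
  the two.\<close>

definition rdist :: "'a set set \<Rightarrow> 'a \<Rightarrow> 'a \<Rightarrow> nat" where
  "rdist E u v = (LEAST p. (u, v) \<in> adj E ^^ p)"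

lemma sym_adj: "sym (adj E)"
  by (auto simp: adj_def sym_def)

lemma adj_mono: "E \<subseteq> E' \<Longrightarrow> adj E \<subseteq> adj E'"
  by (auto simp: adj_def)

lemma conn_refl [simp]: "conn E u u"
  by (simp add: conn_def)

lemma conn_sym: "conn E u v \<Longrightarrow> conn E v u"
  by (metis conn_def sym_rtrancl sym_adj symD)

lemma conn_trans: "conn E u v \<Longrightarrow> conn E v w \<Longrightarrow> conn E u w"
  by (auto simp: conn_def)

lemma conn_edge: "e \<in> E \<Longrightarrow> u \<in> e \<Longrightarrow> v \<in> e \<Longrightarrow> conn E u v"
  by (auto simp: conn_def adj_def)

lemma conn_mono: "conn E u v \<Longrightarrow> E \<subseteq> E' \<Longrightarrow> conn E' u v"
  unfolding conn_def using rtrancl_mono[OF adj_mono] by blast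

lemma conn_induct [consumes 1, case_names refl step]:
  assumes "conn E u v" "P u"
    "\<And>e x y. e \<in> E \<Longrightarrow> x \<in> e \<Longrightarrow> y \<in> e \<Longrightarrow> conn E u x \<Longrightarrow> P x \<Longrightarrow> P y"
  shows "P v"
  using assms(1) unfolding conn_def
proof (induction rule: rtrancl_induct)
  case (step x y)
  then show ?case using assms(3) by (auto simp: adj_def conn_def)
qed (rule assms(2))

lemma conn_iff_relpow: "conn E u v \<longleftrightarrow> (\<exists>p. (u, v) \<in> adj E ^^ p)"
  by (simp add: conn_def rtrancl_power)

lemma relpow_adj_sym: "(u, v) \<in> adj E ^^ p \<longleftrightarrow> (v, u) \<in> adj E ^^ p"
proof -
  have "(v, u) \<in> adj E ^^ p" if "(u, v) \<in> adj E ^^ p" for u v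
    using that
  proof (induction p arbitrary: v)
    case (Suc p)
    then obtain w where "(u, w) \<in> adj E ^^ p" "(w, v) \<in> adj E" by auto
    with Suc.IH show ?case
      using sym_adj by (meson relpow_Suc_I2 symD)
  qed auto
  then show ?thesis by blast
qed

lemma rdist_le: "(u, v) \<in> adj E ^^ p \<Longrightarrow> rdist E u v \<le> p"
  unfolding rdist_def by (rule Least_le)

lemma relpow_rdist: "conn E u v \<Longrightarrow> (u, v) \<in> adj E ^^ rdist E u v"
  unfolding rdist_def conn_iff_relpow by (rule LeastI_ex)

lemma rdist_self [simp]: "rdist E u u = 0"
  using rdist_le[where E = E and u = u and v = u and p = 0] by simp

lemma rdist_sym: "rdist E u v = rdist E v u"
  unfolding rdist_def by (subst relpow_adj_sym) (rule refl)

lemma rdist_eq_0: "conn E u v \<Longrightarrow> rdist E u v = 0 \<longleftrightarrow> u = v"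
  using relpow_rdist[of E u v] by auto

lemma rdist_edge: "e \<in> E \<Longrightarrow> u \<in> e \<Longrightarrow> v \<in> e \<Longrightarrow> rdist E u v \<le> 1"
  by (rule rdist_le) (auto simp: adj_def)

lemma rdist_edge_eq: "e \<in> E \<Longrightarrow> u \<in> e \<Longrightarrow> v \<in> e \<Longrightarrow> u \<noteq> v \<Longrightarrow> rdist E u v = 1"
  using rdist_edge[of e E u v] rdist_eq_0[OF conn_edge, of e E u v] by linarith

lemma rdist_triangle:
  assumes "conn E u v" "conn E v w"
  shows "rdist E u w \<le> rdist E u v + rdist E v w"
  using relpow_trans[OF relpow_rdist[OF assms(1)] relpow_rdist[OF assms(2)]] by (rule rdist_le)

text \<open>Vertex maps that send every edge into an edge or to a single vertex do not increase
  distances. All connectivity and distance comparisons below use maps of this kind which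
  collapse one side of an edge.\<close>

lemma relpow_adj_map:
  assumes "\<And>e. e \<in> E \<Longrightarrow> (\<exists>c. \<phi> ` e \<subseteq> {c}) \<or> (\<exists>e'\<in>E'. \<phi> ` e \<subseteq> e')"
    and "(u, v) \<in> adj E ^^ p"
  shows "(\<phi> u, \<phi> v) \<in> adj E' ^^ p"
  using assms(2)
proof (induction p arbitrary: v)
  case (Suc p)
  then obtain w where w: "(u, w) \<in> adj E ^^ p" "(w, v) \<in> adj E" by auto
  have "(\<phi> w, \<phi> v) \<in> adj E'"
  proof (cases "w = v")
    case False
    then obtain e where e: "e \<in> E" "w \<in> e" "v \<in> e" using w(2) by (auto simp: adj_def)
    from assms(1)[OF e(1)] show ?thesis
    proof
      assume "\<exists>c. \<phi> ` e \<subseteq> {c}"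
      then have "\<phi> w = \<phi> v" using e by auto
      then show ?thesis by (simp add: adj_def)
    next
      assume "\<exists>e'\<in>E'. \<phi> ` e \<subseteq> e'"
      then show ?thesis using e by (auto simp: adj_def)
    qed
  qed (simp add: adj_def)
  with Suc.IH[OF w(1)] show ?case by auto
qed auto

lemma conn_map:
  assumes "conn E u v" "\<And>e. e \<in> E \<Longrightarrow> (\<exists>c. \<phi> ` e \<subseteq> {c}) \<or> (\<exists>e'\<in>E'. \<phi> ` e \<subseteq> e')"
  shows "conn E' (\<phi> u) (\<phi> v)"
  using assms(1) relpow_adj_map[of E \<phi> E', OF assms(2)] unfolding conn_iff_relpow by blast

lemma rdist_map:
  assumes "conn E u v" "\<And>e. e \<in> E \<Longrightarrow> (\<exists>c. \<phi> ` e \<subseteq> {c}) \<or> (\<exists>e'\<in>E'. \<phi> ` e \<subseteq> e')"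
  shows "rdist E' (\<phi> u) (\<phi> v) \<le> rdist E u v"
  by (intro rdist_le relpow_adj_map[of E \<phi> E', OF assms(2)] relpow_rdist assms(1))

text \<open>An edge not contained in \<open>A\<close> meets \<open>A\<close> at most in
  \<open>u\<close>, so a walk from \<open>x\<close> to \<open>y\<close> stays in \<open>A\<close>
  until it reaches \<open>u\<close>; the induction follows it up to that moment.\<close>

lemma rdist_cut:
  assumes cut: "\<And>e. e \<in> E \<Longrightarrow> e \<subseteq> A \<or> e \<inter> A \<subseteq> {u}"
    and "x \<in> A" "y \<notin> A" "conn E x u" "conn E u y"
  shows "rdist E x y = rdist E x u + rdist E u y"
proof (rule antisym)
  show "rdist E x y \<le> rdist E x u + rdist E u y"
    using assms by (intro rdist_triangle)
  have "rdist E x u + rdist E u y \<le> p" if "(x, y) \<in> adj E ^^ p" "x \<in> A" "conn E x u" for p x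
    using that
  proof (induction p arbitrary: x)
    case 0
    then show ?case using \<open>y \<notin> A\<close> by simp
  next
    case (Suc p)
    show ?case
    proof (cases "x = u")
      case True
      then show ?thesis using rdist_le[OF Suc.prems(1)] by simp
    next
      case False
      obtain z where z: "(x, z) \<in> adj E" "(z, y) \<in> adj E ^^ p"
        using relpow_Suc_D2[OF Suc.prems(1)] by blast
      have "z \<in> A"
        using z(1) cut False Suc.prems(2) by (fastforce simp: adj_def)
      have xz: "conn E x z" using z(1) by (auto simp: conn_def)
      then have zu: "conn E z u" using Suc.prems(3) conn_sym conn_trans by metis
      have "rdist E x z \<le> 1" using z(1) by (intro rdist_le) simp
      then have "rdist E x u \<le> 1 + rdist E z u"
        using rdist_triangle[OF xz zu] by simp
      with Suc.IH[OF z(2) \<open>z \<in> A\<close> zu] show ?thesis by simp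
    qed
  qed
  moreover have "conn E x y" using assms conn_trans by metis
  ultimately show "rdist E x u + rdist E u y \<le> rdist E x y"
    using assms relpow_rdist by metis
qed

section \<open>Branches of an edge and distances between them\<close>

definition branch :: "'a set set \<Rightarrow> 'a set \<Rightarrow> 'a \<Rightarrow> 'a set" where
  "branch E e u = {y. conn (E - {e}) u y}"

lemma branch_refl [simp]: "u \<in> branch E e u"
  by (simp add: branch_def)

text \<open>Acyclicity is encoded by \<open>bridge\<close>: deleting an edge separates its vertices
  pairwise. The link to \<open>hypertree\<close> is \<open>hypertree_iff_htree\<close>.\<close>

locale htree =
  fixes V :: "'a set" and E :: "'a set set"
  assumes finite_V: "finite V" and V_nonempty: "V \<noteq> {}"
    and edge_nonempty: "e \<in> E \<Longrightarrow> e \<noteq> {}" and edge_subset: "e \<in> E \<Longrightarrow> e \<subseteq> V"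
    and connected: "u \<in> V \<Longrightarrow> v \<in> V \<Longrightarrow> conn E u v"
    and bridge: "e \<in> E \<Longrightarrow> u \<in> e \<Longrightarrow> v \<in> e \<Longrightarrow> conn (E - {e}) u v \<Longrightarrow> u = v"
begin

lemma edge_in_V: "e \<in> E \<Longrightarrow> u \<in> e \<Longrightarrow> u \<in> V"
  using edge_subset by blast

lemma branch_subset:
  assumes "u \<in> V" shows "branch E e u \<subseteq> V"
proof
  fix y assume "y \<in> branch E e u"
  then have "conn (E - {e}) u y" by (simp add: branch_def)
  then show "y \<in> V"
    by (induction rule: conn_induct) (use assms edge_subset in auto)
qed

lemma branch_unique:
  assumes "e \<in> E" "u \<in> e" "v \<in> e" "y \<in> branch E e u" "y \<in> branch E e v"
  shows "u = v"
  using assms bridge[of e u v] conn_trans conn_sym by (metis branch_def mem_Collect_eq)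

lemma edge_branch: "e \<in> E \<Longrightarrow> u \<in> e \<Longrightarrow> v \<in> e \<Longrightarrow> v \<in> branch E e u \<longleftrightarrow> v = u"
  using bridge by (auto simp: branch_def)

text \<open>Follow a walk from a vertex of \<open>e\<close> to \<open>x\<close>: other edges keep it
  in the current branch, and \<open>e\<close> leads to the root of a branch. With
  \<open>branch_unique\<close>, the branches of \<open>e\<close> partition \<open>V\<close>.\<close>

lemma branch_cover:
  assumes "e \<in> E" "x \<in> V"
  obtains u where "u \<in> e" "x \<in> branch E e u"
proof -
  obtain w where w: "w \<in> e" using edge_nonempty assms by blast
  then have "conn E w x" using assms connected edge_in_V by blast
  then have "\<exists>u\<in>e. x \<in> branch E e u"
  proof (induction rule: conn_induct)
    case refl
    show ?case by (intro bexI[of _ w] w branch_refl)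
  next
    case (step h x y)
    then obtain u where u: "u \<in> e" "x \<in> branch E e u" by blast
    show ?case
    proof (cases "h = e")
      case True
      then show ?thesis using step by (intro bexI[of _ y] branch_refl) auto
    next
      case False
      then have "conn (E - {e}) x y" using step by (intro conn_edge[of h]) auto
      moreover have "conn (E - {e}) u x" using u by (simp add: branch_def)
      ultimately have "conn (E - {e}) u y" using conn_trans by metis
      then show ?thesis using u by (auto simp: branch_def)
    qed
  qed
  then show ?thesis using that by blast
qed

lemma edge_in_branch:
  assumes "h \<in> E" "h \<noteq> e"
  shows "h \<subseteq> branch E e u \<or> h \<inter> branch E e u = {}"
proof -
  have "y \<in> branch E e u" if "x \<in> h" "x \<in> branch E e u" "y \<in> h" for x y
  proof -
    have "conn (E - {e}) x y" using that assms by (intro conn_edge[of h]) auto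
    then show ?thesis using that(2) conn_trans by (auto simp: branch_def)
  qed
  then show ?thesis by blast
qed

lemma rdist_branch:
  assumes "e \<in> E" "u \<in> e" "x \<in> branch E e u" "y \<in> V" "y \<notin> branch E e u"
  shows "rdist E x y = rdist E x u + rdist E u y"
proof (rule rdist_cut[where A = "branch E e u"])
  fix h assume "h \<in> E"
  then show "h \<subseteq> branch E e u \<or> h \<inter> branch E e u \<subseteq> {u}"
    using edge_in_branch[of h e u] edge_branch assms by (cases "h = e") auto
next
  have "u \<in> V" using assms edge_in_V by blast
  moreover from this have "x \<in> V" using branch_subset assms by blast
  ultimately show "conn E x u" "conn E u y" using connected assms by auto
qed (use assms in auto)

lemma rdist_other_branch:
  assumes "e \<in> E" "u \<in> e" "v \<in> e" "u \<noteq> v" "y \<in> branch E e v"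
  shows "rdist E u y = Suc (rdist E v y)"
proof -
  have "u \<notin> branch E e v" using edge_branch assms by blast
  then have "rdist E y u = rdist E y v + rdist E v u"
    using rdist_branch[of e v y u] assms edge_in_V by blast
  moreover have "rdist E v u = 1" using rdist_edge_eq assms by metis
  ultimately show ?thesis by (simp add: rdist_sym)
qed

text \<open>The branch of \<open>e\<close> at \<open>v\<close> misses \<open>u\<close>, so walks
  inside it avoid \<open>f\<close>. Collapsing everything else to \<open>v\<close> yields such a
  walk, and \<open>e\<close> links \<open>v\<close> to \<open>u\<close>.\<close>

lemma branch_subset_branch:
  assumes "e \<in> E" "f \<in> E" "e \<noteq> f" "u \<in> e" "u \<in> f" "v \<in> e" "v \<noteq> u"
  shows "branch E e v \<subseteq> branch E f u"
proof
  fix y assume y: "y \<in> branch E e v"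
  define \<phi> where "\<phi> = (\<lambda>z. if z \<in> branch E e v then z else v)"
  have "conn (E - {f}) (\<phi> v) (\<phi> y)"
  proof (rule conn_map[where \<phi> = \<phi>])
    show "conn (E - {e}) v y" using y by (simp add: branch_def)
  next
    fix h assume h: "h \<in> E - {e}"
    show "(\<exists>c. \<phi> ` h \<subseteq> {c}) \<or> (\<exists>e'\<in>E - {f}. \<phi> ` h \<subseteq> e')"
    proof (cases "h \<subseteq> branch E e v")
      case True
      moreover have "u \<notin> branch E e v" using edge_branch assms by blast
      ultimately have "h \<noteq> f" using assms by blast
      moreover have "\<phi> ` h = h" using True by (force simp: \<phi>_def)
      ultimately show ?thesis using h by (intro disjI2 bexI[of _ h]) auto
    next
      case False
      then have "\<phi> ` h \<subseteq> {v}" using edge_in_branch[of h e v] h by (auto simp: \<phi>_def)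
      then show ?thesis by blast
    qed
  qed
  then have "conn (E - {f}) v y" using y by (simp add: \<phi>_def)
  moreover have "conn (E - {f}) u v" using assms by (intro conn_edge[of e]) auto
  ultimately show "y \<in> branch E f u" using conn_trans by (auto simp: branch_def)
qed

end

section \<open>Moving an edge inside a branch\<close>

definition move_edge :: "'a set set \<Rightarrow> 'a set \<Rightarrow> 'a \<Rightarrow> 'a \<Rightarrow> 'a set set" where
  "move_edge E f u a = insert (insert a (f - {u})) (E - {f})"

text \<open>By \<open>f \<noteq> {u}\<close> some vertex of \<open>f\<close> lies outside
  \<open>B\<close>, so the moved edge still joins \<open>B\<close> to the rest. The case
  \<open>a = u\<close>, where nothing changes, is allowed.\<close>

locale edge_move = htree +
  fixes f u a
  assumes f: "f \<in> E" and u: "u \<in> f" and f_ne: "f \<noteq> {u}" and a: "a \<in> branch E f u"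
begin

abbreviation "B \<equiv> branch E f u"
abbreviation "f' \<equiv> insert a (f - {u})"
abbreviation "E' \<equiv> move_edge E f u a"

lemma f_B: "v \<in> f \<Longrightarrow> v \<in> B \<longleftrightarrow> v = u"
  using edge_branch f u by blast

lemma B_subset: "B \<subseteq> V"
  using branch_subset edge_in_V f u by blast

lemma f'_notin: "f' \<notin> E - {f}"
proof
  assume "f' \<in> E - {f}"
  then have "f' \<subseteq> B" using edge_in_branch[of f' f u] a by blast
  moreover obtain v where "v \<in> f" "v \<noteq> u" using f_ne u by blast
  ultimately show False using f_B by blast
qed

lemma E'_cases:
  assumes "h \<in> E'"
  obtains "h = f'" | "h \<in> E" "h \<noteq> f" "h \<noteq> f'" "h \<subseteq> B" | "h \<in> E" "h \<noteq> f" "h \<noteq> f'" "h \<inter> B = {}"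
  using assms f'_notin edge_in_branch[of h f u] unfolding move_edge_def by fast

lemma E_cases:
  assumes "h \<in> E"
  obtains "h = f" | "h \<in> E'" "h \<noteq> f" "h \<subseteq> B" | "h \<in> E'" "h \<noteq> f" "h \<inter> B = {}"
  using assms edge_in_branch[of h f u] unfolding move_edge_def by fast

lemma E'_minus_f': "E' - {f'} = E - {f}"
  using f'_notin by (auto simp: move_edge_def)

text \<open>Retraction onto \<open>B\<close>, under which \<open>f'\<close> shrinks to
  \<open>a\<close>. The intersection with \<open>{h}\<close> records that an edge is sent into
  itself, so the map remains usable after deleting the same edge on both sides.\<close>

lemma collapse_to_a:
  assumes "h \<in> E'"
  shows "(\<exists>c. (\<lambda>z. if z \<in> B then z else a) ` h \<subseteq> {c}) \<or>
    (\<exists>h'\<in>E \<inter> {h}. (\<lambda>z. if z \<in> B then z else a) ` h \<subseteq> h')"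
  using assms(1)
proof (cases rule: E'_cases)
  case 1
  then show ?thesis using f_B by (intro disjI1 exI[of _ a]) auto
next
  case 2
  then show ?thesis using assms by (intro disjI2 bexI[of _ h]) auto
next
  case 3
  then show ?thesis by (intro disjI1 exI[of _ a]) auto
qed

text \<open>Contracts \<open>B\<close> to \<open>u\<close>, which carries \<open>f'\<close> onto
  \<open>f\<close>. The possible targets \<open>h\<close> and \<open>f\<close> are again recorded
  for use after a deletion.\<close>

lemma collapse_to_u:
  assumes "h \<in> E'"
  shows "(\<exists>c. (\<lambda>z. if z \<in> B then u else z) ` h \<subseteq> {c}) \<or>
    (\<exists>h'\<in>E \<inter> {h, f}. (\<lambda>z. if z \<in> B then u else z) ` h \<subseteq> h')"
  using assms(1)
proof (cases rule: E'_cases)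
  case 1
  then show ?thesis using f u assms a by (intro disjI2 bexI[of _ f]) auto
next
  case 2
  then show ?thesis by (intro disjI1 exI[of _ u]) auto
next
  case 3
  then show ?thesis using assms by (intro disjI2 bexI[of _ h]) auto
qed

text \<open>This and \<open>collapse_to_a'\<close> are the counterparts from \<open>E\<close> to
  \<open>E'\<close>: here \<open>f\<close> shrinks to \<open>u\<close>, there it is carried onto
  \<open>f'\<close>.\<close>

lemma collapse_to_u':
  assumes "h \<in> E"
  shows "(\<exists>c. (\<lambda>z. if z \<in> B then z else u) ` h \<subseteq> {c}) \<or>
    (\<exists>h'\<in>E'. (\<lambda>z. if z \<in> B then z else u) ` h \<subseteq> h')"
  using assms(1)
proof (cases rule: E_cases)
  case 1
  then show ?thesis using f_B by (intro disjI1 exI[of _ u]) auto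
next
  case 2
  then show ?thesis by (intro disjI2 bexI[of _ h]) auto
next
  case 3
  then show ?thesis by (intro disjI1 exI[of _ u]) auto
qed

lemma collapse_to_a':
  assumes "h \<in> E"
  shows "(\<exists>c. (\<lambda>z. if z \<in> B then a else z) ` h \<subseteq> {c}) \<or>
    (\<exists>h'\<in>E'. (\<lambda>z. if z \<in> B then a else z) ` h \<subseteq> h')"
  using assms(1)
proof (cases rule: E_cases)
  case 1
  then show ?thesis using f_B by (intro disjI2 bexI[of _ f']) (auto simp: move_edge_def)
next
  case 2
  then show ?thesis by (intro disjI1 exI[of _ a]) auto
next
  case 3
  then show ?thesis by (intro disjI2 bexI[of _ h]) auto
qed

lemma conn_a: 
  assumes z: "z \<in> V" shows "conn E' a z"
proof -
  obtain v where v: "v \<in> f" "z \<in> branch E f v" using branch_cover f z by blast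
  have sub: "E - {f} \<subseteq> E'" by (auto simp: move_edge_def)
  have vz: "conn E' v z" using v(2) conn_mono[OF _ sub] by (simp add: branch_def)
  show ?thesis
  proof (cases "v = u")
    case True
    have "conn E' u a" using a conn_mono[OF _ sub] by (simp add: branch_def)
    then show ?thesis using vz True conn_sym conn_trans by metis
  next
    case False
    then have "conn E' a v" using v by (intro conn_edge[of f']) (auto simp: move_edge_def)
    then show ?thesis using vz conn_trans by metis
  qed
qed

lemma htree_move: "htree V E'"
proof
  show "finite V" "V \<noteq> {}" using finite_V V_nonempty by auto
  show "e \<noteq> {}" if "e \<in> E'" for e using that edge_nonempty by (auto simp: move_edge_def)
  show "e \<subseteq> V" if "e \<in> E'" for e
    using that edge_subset f B_subset a by (auto simp: move_edge_def)
  show "conn E' x y" if "x \<in> V" "y \<in> V" for x y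
    using conn_a that conn_sym conn_trans by metis
next
  fix h x y
  assume h: "h \<in> E'" "x \<in> h" "y \<in> h" and c: "conn (E' - {h}) x y"
  from h(1) show "x = y"
  proof (cases rule: E'_cases)
    case 1
    have ua: "conn (E - {f}) u a" using a by (simp add: branch_def)
    have xy: "conn (E - {f}) x y" using c 1 E'_minus_f' by simp
    \<comment> \<open>Replacing \<open>a\<close> by \<open>u\<close>, connected to it without
      \<open>f\<close>, turns vertices of \<open>f'\<close> into vertices of \<open>f\<close>, to
      which \<open>bridge\<close> applies.\<close>
    define x' where "x' = (if x = a then u else x)"
    define y' where "y' = (if y = a then u else y)"
    have "conn (E - {f}) x' y'"
      using xy ua conn_sym conn_trans unfolding x'_def y'_def by (smt (verit))
    moreover have "x' \<in> f" "y' \<in> f" using h 1 u by (auto simp: x'_def y'_def)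
    ultimately have "x' = y'" using bridge f by blast
    then show ?thesis
      using h 1 f_B a by (auto simp: x'_def y'_def split: if_splits)
  next
    case 2
    have "conn (E - {h}) (if x \<in> B then x else a) (if y \<in> B then y else a)"
      by (rule conn_map[OF c, where \<phi> = "\<lambda>z. if z \<in> B then z else a"]) (use collapse_to_a in blast)
    moreover have "x \<in> B" "y \<in> B" using 2 h by auto
    ultimately show ?thesis using 2 h bridge[of h x y] by simp
  next
    case 3
    have "conn (E - {h}) (if x \<in> B then u else x) (if y \<in> B then u else y)"
    proof (rule conn_map[OF c, where \<phi> = "\<lambda>z. if z \<in> B then u else z"])
      fix k assume k: "k \<in> E' - {h}"
      then have "E \<inter> {k, f} \<subseteq> E - {h}" using 3 by auto
      then show "(\<exists>c. (\<lambda>z. if z \<in> B then u else z) ` k \<subseteq> {c}) \<or>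
          (\<exists>e'\<in>E - {h}. (\<lambda>z. if z \<in> B then u else z) ` k \<subseteq> e')"
        using collapse_to_u[of k] k by (meson DiffD1 subsetD)
    qed
    moreover have "x \<notin> B" "y \<notin> B" using 3 h by auto
    ultimately show ?thesis using 3 h bridge[of h x y] by simp
  qed
qed

interpretation M: htree V E'
  by (rule htree_move)

text \<open>Both inequalities come from retractions onto \<open>B\<close>, one from \<open>E\<close>
  to \<open>E'\<close> and one back. The next two lemmas use the contractions of \<open>B\<close> in
  the same way.\<close>

lemma rdist_move_inside:
  assumes "x \<in> B" "y \<in> B"
  shows "rdist E' x y = rdist E x y"
proof (rule antisym)
  have V: "x \<in> V" "y \<in> V" using assms B_subset by auto
  have "rdist E' (if x \<in> B then x else u) (if y \<in> B then y else u) \<le> rdist E x y"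
    by (rule rdist_map[OF connected[OF V], where \<phi> = "\<lambda>z. if z \<in> B then z else u"]) (use collapse_to_u' in blast)
  then show "rdist E' x y \<le> rdist E x y" using assms by simp
  have "rdist E (if x \<in> B then x else a) (if y \<in> B then y else a) \<le> rdist E' x y"
    by (rule rdist_map[OF M.connected[OF V], where \<phi> = "\<lambda>z. if z \<in> B then z else a"]) (use collapse_to_a in blast)
  then show "rdist E x y \<le> rdist E' x y" using assms by simp
qed

lemma rdist_move_outside:
  assumes "x \<in> V - B" "y \<in> V - B"
  shows "rdist E' x y = rdist E x y" 
proof (rule antisym)
  have V: "x \<in> V" "y \<in> V" using assms by auto
  have "rdist E' (if x \<in> B then a else x) (if y \<in> B then a else y) \<le> rdist E x y"
    by (rule rdist_map[OF connected[OF V], where \<phi> = "\<lambda>z. if z \<in> B then a else z"]) (use collapse_to_a' in blast)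
  then show "rdist E' x y \<le> rdist E x y" using assms by simp
  have "rdist E (if x \<in> B then u else x) (if y \<in> B then u else y) \<le> rdist E' x y"
    by (rule rdist_map[OF M.connected[OF V], where \<phi> = "\<lambda>z. if z \<in> B then u else z"]) (use collapse_to_u in blast)
  then show "rdist E x y \<le> rdist E' x y" using assms by simp
qed

lemma rdist_move_a:
  assumes "x \<in> V - B"
  shows "rdist E' x a = rdist E x u" 
proof (rule antisym)
  have V: "x \<in> V" "a \<in> V" "u \<in> V" using assms B_subset a edge_in_V f u by auto
  have "rdist E' (if x \<in> B then a else x) (if u \<in> B then a else u) \<le> rdist E x u"
    by (rule rdist_map[OF connected[OF V(1) V(3)], where \<phi> = "\<lambda>z. if z \<in> B then a else z"]) (use collapse_to_a' in blast)
  then show "rdist E' x a \<le> rdist E x u" using assms by simp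
  have "rdist E (if x \<in> B then u else x) (if a \<in> B then u else a) \<le> rdist E' x a"
    by (rule rdist_map[OF M.connected[OF V(1,2)], where \<phi> = "\<lambda>z. if z \<in> B then u else z"]) (use collapse_to_u in blast)
  then show "rdist E x u \<le> rdist E' x a" using assms a by simp
qed

text \<open>In \<open>E'\<close> only \<open>f'\<close> links \<open>B\<close> to the rest, and it
  meets \<open>B\<close> in \<open>a\<close>, which takes over from \<open>u\<close> as the cut
  vertex.\<close>

lemma rdist_move_across:
  assumes "x \<in> V - B" "y \<in> B"
  shows "rdist E' x y = rdist E x u + rdist E a y"
proof -
  have "rdist E' y x = rdist E' y a + rdist E' a x"
  proof (rule rdist_cut[where A = B])
    fix h assume "h \<in> E'"
    then show "h \<subseteq> B \<or> h \<inter> B \<subseteq> {a}"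
      by (cases rule: E'_cases) (use f_B in auto)
  qed (use assms M.connected a B_subset in auto)
  then show ?thesis
    using rdist_move_a[OF assms(1)] rdist_move_inside[OF assms(2) a] by (simp add: rdist_sym)
qed

end

section \<open>Walks and relational distance\<close>

text \<open>The segment bounds and the set \<open>F\<close> allow two uses: a whole path with all
  edges, and a cycle without its first edge.\<close>

lemma walk_relpow:
  assumes w: "walk G vs es" and "i \<le> j" "j \<le> length es"
    and F: "\<And>k. i \<le> k \<Longrightarrow> k < j \<Longrightarrow> es ! k \<in> F"
  shows "(vs ! i, vs ! j) \<in> adj F ^^ (j - i)"
  using assms(2,3) F
proof (induction j rule: dec_induct)
  case (step n)
  then have "(vs ! i, vs ! n) \<in> adj F ^^ (n - i)" by simp
  moreover have "(vs ! n, vs ! Suc n) \<in> adj F"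
  proof -
    have "n < length es" "es ! n \<in> F" using step by auto
    then have "vs ! n \<in> es ! n \<and> vs ! Suc n \<in> es ! n" using w by (simp add: walk_def)
    with \<open>es ! n \<in> F\<close> show ?thesis unfolding adj_def by blast
  qed
  ultimately show ?case using step.hyps by (auto simp: Suc_diff_le)
qed auto

lemma walk_hd_last:
  assumes "walk G vs es" shows "hd vs = vs ! 0" "last vs = vs ! length es"
proof -
  have "vs \<noteq> []" "length vs = Suc (length es)" using assms by (auto simp: walk_def)
  then show "hd vs = vs ! 0" "last vs = vs ! length es" by (auto simp: hd_conv_nth last_conv_nth)
qed

lemma path_between_relpow:
  assumes "path_between G u v vs es"
  shows "(u, v) \<in> adj (edges G) ^^ length es"
proof -
  have w: "walk G vs es" and uv: "hd vs = u" "last vs = v"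
    using assms by (auto simp: path_between_def)
  have "(vs ! 0, vs ! length es) \<in> adj (edges G) ^^ (length es - 0)"
    using w by (intro walk_relpow[OF w]) (auto simp: walk_def)
  then show ?thesis using uv walk_hd_last[OF w] by simp
qed

text \<open>A sequence realising \<open>rdist\<close> admits no shortcut between two of its
  positions. A repeated vertex or edge would be one, so the sequence is a path.\<close>

lemma ex_shortest_path:
  fixes G :: "'a hypergraph"
  assumes sub: "\<And>e. e \<in> edges G \<Longrightarrow> e \<subseteq> verts G" and u: "u \<in> verts G"
    and c: "conn (edges G) u v"
  obtains vs es where "path_between G u v vs es" "length es = rdist (edges G) u v"
proof -
  let ?R = "adj (edges G)"
  define p where "p = rdist (edges G) u v"
  have "(u, v) \<in> ?R ^^ p" unfolding p_def by (rule relpow_rdist[OF c])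
  then obtain f where f: "f 0 = u" "f p = v" "\<And>i. i < p \<Longrightarrow> (f i, f (Suc i)) \<in> ?R"
    by (auto simp: relpow_fun_conv)
  have seg: "(f i, f j) \<in> ?R ^^ (j - i)" if "i \<le> j" "j \<le> p" for i j
    using that by (subst relpow_fun_conv) (rule exI[of _ "\<lambda>k. f (i + k)"], use f(3) in auto)
  have short: "j - i \<le> q" if "i \<le> j" "j \<le> p" "(f i, f j) \<in> ?R ^^ q" for i j q
  proof -
    have "(f 0, f i) \<in> ?R ^^ i" "(f j, f p) \<in> ?R ^^ (p - j)" using seg[of 0 i] seg[of j p] that by auto
    then have "(u, v) \<in> ?R ^^ (i + q + (p - j))" using that(3) relpow_trans f(1,2) by metis
    then have "p \<le> i + q + (p - j)" using rdist_le p_def by metis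
    then show ?thesis using that by simp
  qed
  have neq: "f i \<noteq> f j" if "i < j" "j \<le> p" for i j
    using short[of i j 0] that by auto
  have "\<exists>e\<in>edges G. f i \<in> e \<and> f (Suc i) \<in> e" if "i < p" for i
    using f(3)[OF that] neq[of i "Suc i"] that by (auto simp: adj_def)
  then obtain g where g: "\<And>i. i < p \<Longrightarrow> g i \<in> edges G \<and> f i \<in> g i \<and> f (Suc i) \<in> g i"
    by metis
  have gneq: "g i \<noteq> g j" if "i < j" "j < p" for i j
  proof
    assume "g i = g j"
    then have "(f i, f (Suc j)) \<in> ?R ^^ 1" using g[of i] g[of j] that by (auto simp: adj_def)
    then show False using short[of i "Suc j" 1] that by auto
  qed
  let ?vs = "map f [0..<Suc p]" and ?es = "map g [0..<p]"
  have vs: "?vs ! i = f i" if "i \<le> p" for i using that by (simp del: upt_Suc)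
  have "f i \<in> verts G" if "i \<le> p" for i
  proof (cases i)
    case 0
    then show ?thesis using f(1) u by simp
  next
    case (Suc j)
    then show ?thesis using g[of j] sub that by auto
  qed
  then have "walk G ?vs ?es"
    unfolding walk_def using g neq vs by (auto simp del: upt_Suc)
  moreover have "distinct ?vs"
    unfolding distinct_map by (auto simp del: upt_Suc intro!: inj_onI) (metis linorder_neqE_nat less_Suc_eq_le neq)
  moreover have "distinct ?es"
    unfolding distinct_map by (auto intro!: inj_onI) (metis linorder_neqE_nat gneq)
  moreover have "hd ?vs = u" "last ?vs = v"
    using walk_hd_last[OF \<open>walk G ?vs ?es\<close>] f(1,2) vs by (auto simp del: upt_Suc)
  ultimately show ?thesis
    by (intro that[of ?vs ?es]) (auto simp: path_between_def p_def)
qed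

lemma hdist_eq_rdist:
  assumes sub: "\<And>e. e \<in> edges G \<Longrightarrow> e \<subseteq> verts G" and u: "u \<in> verts G"
  shows "hdist G u v = rdist (edges G) u v"
proof (cases "conn (edges G) u v")
  case True
  show ?thesis
    unfolding hdist_def
  proof (rule Least_equality)
    show "\<exists>vs es. path_between G u v vs es \<and> length es = rdist (edges G) u v"
      using ex_shortest_path[OF sub u True] by metis
  qed (auto dest: path_between_relpow intro: rdist_le)
next
  case False
  then have "\<not> path_between G u v vs es" for vs es
    using path_between_relpow[of G u v vs es] conn_iff_relpow by metis
  moreover have "(u, v) \<notin> adj (edges G) ^^ p" for p
    using False by (auto simp: conn_iff_relpow)
  \<comment> \<open>Neither side has a candidate length, so both \<open>LEAST\<close> terms belong
    to the everywhere false predicate and coincide.\<close>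
  ultimately show ?thesis by (simp add: hdist_def rdist_def)
qed

text \<open>A path avoiding \<open>e\<close> between two vertices of \<open>e\<close> closes up with
  \<open>e\<close> to a cycle. Conversely, a cycle without its first edge still connects two
  distinct vertices of that edge.\<close>

lemma hypertree_iff_htree: "hypertree G \<longleftrightarrow> htree (verts G) (edges G)"
proof
  assume h: "hypertree G"
  then have hg: "hypergraph G" and hc: "hconnected G" and nc: "\<And>vs es. \<not> hcycle G vs es"
    by (auto simp: hypertree_def)
  show "htree (verts G) (edges G)"
  proof
    show "conn (edges G) u v" if "u \<in> verts G" "v \<in> verts G" for u v
      using hc that path_between_relpow unfolding hconnected_def conn_iff_relpow by metis
    show "u = v" if e: "e \<in> edges G" "u \<in> e" "v \<in> e" and c: "conn (edges G - {e}) u v" for e u v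
    proof (rule ccontr)
      assume "u \<noteq> v"
      let ?H = "\<lparr>verts = verts G, edges = edges G - {e}\<rparr>"
      have "u \<in> verts G" using e hg by (auto simp: hypergraph_def)
      moreover have "f \<subseteq> verts G" if "f \<in> edges G" for f using that hg by (auto simp: hypergraph_def)
      ultimately obtain vs es where p: "path_between ?H u v vs es"
        using ex_shortest_path[of ?H u v] c by force
      then have w: "walk ?H vs es" "hd vs = u" "last vs = v" "distinct vs" "distinct es"
        by (auto simp: path_between_def)
      have len: "length vs = Suc (length es)" using w by (simp add: walk_def)
      have "es \<noteq> []" using w \<open>u \<noteq> v\<close> len by (cases vs) auto
      have last: "vs ! length es = v" using w walk_hd_last by metis
      have "walk G (vs @ [u]) (es @ [e])"
        using w(1) e \<open>u \<in> verts G\<close> \<open>u \<noteq> v\<close> last len unfolding walk_def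
        by (auto simp: nth_append less_Suc_eq)
      moreover have "distinct (es @ [e])" using w by (auto simp: walk_def)
      moreover have "hd (vs @ [u]) = last (vs @ [u])" using w len by (cases vs) auto
      moreover have "distinct (tl (vs @ [u]))" using w len by (cases vs) auto
      ultimately have "hcycle G (vs @ [u]) (es @ [e])"
        using \<open>es \<noteq> []\<close> by (auto simp: hcycle_def Suc_le_eq)
      then show False using nc by blast
    qed
  qed (use hg in \<open>auto simp: hypergraph_def\<close>)
next
  assume "htree (verts G) (edges G)"
  then interpret htree "verts G" "edges G" .
  have "hypergraph G"
    unfolding hypergraph_def using finite_V V_nonempty edge_nonempty edge_subset by blast
  moreover have "hconnected G"
    unfolding hconnected_def using ex_shortest_path[OF edge_subset _ connected] by metis
  moreover have "\<not> hcycle G vs es" for vs es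
  proof
    assume h: "hcycle G vs es"
    then have w: "walk G vs es" and len: "length es \<ge> 2" and d: "distinct es" "hd vs = last vs"
      by (auto simp: hcycle_def)
    have "(vs ! 1, vs ! length es) \<in> adj (edges G - {es ! 0}) ^^ (length es - 1)"
    proof (rule walk_relpow[OF w])
      fix k assume "1 \<le> k" "k < length es"
      moreover from this have "(es ! k = es ! 0) = (k = 0)"
        by (intro nth_eq_iff_index_eq[OF d(1)]) linarith+
      moreover have "es ! k \<in> edges G"
        using w \<open>k < length es\<close> nth_mem unfolding walk_def by blast
      ultimately show "es ! k \<in> edges G - {es ! 0}" by simp
    qed (use len in auto)
    then have "conn (edges G - {es ! 0}) (vs ! 1) (vs ! 0)"
      using walk_hd_last[OF w] d unfolding conn_iff_relpow by metis
    moreover have "0 < length es" using len by linarith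
    then have "es ! 0 \<in> edges G" "vs ! 0 \<in> es ! 0" "vs ! 1 \<in> es ! 0" "vs ! 0 \<noteq> vs ! 1"
      using w nth_mem[of 0 es] unfolding walk_def One_nat_def by blast+
    ultimately show False using bridge by metis
  qed
  ultimately show "hypertree G" by (auto simp: hypertree_def)
qed

section \<open>Perron vectors of hypertrees and invariance under isomorphism\<close>

lemma rdist_bij_betw:
  assumes f: "bij_betw f V W" and sub: "\<And>e. e \<in> E \<Longrightarrow> e \<subseteq> V" and F: "(\<lambda>e. f ` e) ` E = F"
    and uv: "u \<in> V" "v \<in> V" and c: "conn E u v"
  shows "rdist F (f u) (f v) = rdist E u v"
proof (rule antisym)
  have 1: "(\<exists>c. f ` e \<subseteq> {c}) \<or> (\<exists>e'\<in>F. f ` e \<subseteq> e')" if "e \<in> E" for e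
    using that F by blast
  show "rdist F (f u) (f v) \<le> rdist E u v"
    using c 1 by (rule rdist_map)
  let ?g = "inv_into V f"
  have g: "?g (f x) = x" if "x \<in> V" for x using bij_betw_inv_into_left[OF f that] .
  have c': "conn F (f u) (f v)" using c 1 by (rule conn_map)
  have "rdist E (?g (f u)) (?g (f v)) \<le> rdist F (f u) (f v)"
    using c'
  proof (rule rdist_map)
    fix e' assume "e' \<in> F"
    then obtain e where e: "e \<in> E" "e' = f ` e" using F by blast
    then have "?g ` e' \<subseteq> e" using sub[OF e(1)] g by auto
    then show "(\<exists>c. ?g ` e' \<subseteq> {c}) \<or> (\<exists>e\<in>E. ?g ` e' \<subseteq> e)" using e by blast
  qed
  then show "rdist E u v \<le> rdist F (f u) (f v)" using g uv by simp
qed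

lemma hypertree_hdist:
  assumes "hypertree G" "u \<in> verts G"
  shows "hdist G u v = rdist (edges G) u v"
  using assms htree.edge_subset by (intro hdist_eq_rdist) (auto simp: hypertree_iff_htree)

lemma hypertree_perron:
  assumes G: "hypertree G" and card: "card (verts G) \<ge> 2"
  obtains x where "\<And>u. u \<in> verts G \<Longrightarrow> x u > 0"
    "\<And>u. u \<in> verts G \<Longrightarrow>
       (\<Sum>v\<in>verts G. real (rdist (edges G) u v) * x v) = dist_spectral_radius G * x u"
    "\<And>y. qform (verts G) (\<lambda>u v. real (rdist (edges G) u v)) y
       \<le> dist_spectral_radius G * (\<Sum>v\<in>verts G. (y v)\<^sup>2)"
proof -
  interpret htree "verts G" "edges G" using G by (simp add: hypertree_iff_htree)
  have eq: "hdist G u v = rdist (edges G) u v" if "u \<in> verts G" for u v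
    using hypertree_hdist[OF G that] .
  have q: "qform (verts G) (\<lambda>u v. real (hdist G u v)) y = qform (verts G) (\<lambda>u v. real (rdist (edges G) u v)) y" for y
    by (rule qform_cong) (auto simp: eq)
  obtain x where x: "\<And>u. u \<in> verts G \<Longrightarrow> x u > 0"
    "\<And>u. u \<in> verts G \<Longrightarrow>
       (\<Sum>v\<in>verts G. real (hdist G u v) * x v) = dist_spectral_radius G * x u"
    "\<And>y. qform (verts G) (\<lambda>u v. real (hdist G u v)) y
       \<le> dist_spectral_radius G * (\<Sum>v\<in>verts G. (y v)\<^sup>2)"
  proof (rule dist_spectral_radius_perron[OF finite_V card])
    show "hdist G u v = hdist G v u" if "u \<in> verts G" "v \<in> verts G" for u v
      using that rdist_sym by (simp only: eq)
    show "hdist G u v = 0 \<longleftrightarrow> u = v" if "u \<in> verts G" "v \<in> verts G" for u v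
      using that by (simp add: eq rdist_eq_0 connected)
  qed blast
  show ?thesis by (rule that[of x]) (use x q eq in simp_all)
qed

text \<open>The Perron vector of \<open>G\<close>, transported along the isomorphism, certifies the
  same value for \<open>H\<close>. As only \<open>G\<close> is assumed to be a hypertree, this can
  be applied to \<open>loose_path\<close> without a separate proof that it is one.\<close>

lemma dist_spectral_radius_isomorphic:
  assumes G: "hypertree G" and card: "card (verts G) \<ge> 2" and iso: "isomorphic G H"
  shows "dist_spectral_radius H = dist_spectral_radius G"
proof -
  interpret htree "verts G" "edges G" using G by (simp add: hypertree_iff_htree)
  obtain f where f: "bij_betw f (verts G) (verts H)" "(\<lambda>e. f ` e) ` edges G = edges H"
    using iso by (auto simp: isomorphic_def)
  let ?g = "inv_into (verts G) f"
  have g: "?g (f x) = x" if "x \<in> verts G" for x using bij_betw_inv_into_left[OF f(1) that] .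
  have img: "verts H = f ` verts G" using f by (simp add: bij_betw_def)
  have sub: "e \<subseteq> verts H" if "e \<in> edges H" for e
  proof -
    obtain e' where "e' \<in> edges G" "e = f ` e'" using \<open>e \<in> edges H\<close> f(2) by blast
    then show ?thesis using edge_subset[of e'] img by blast
  qed
  have d: "hdist H (f u) (f v) = rdist (edges G) u v" if "u \<in> verts G" "v \<in> verts G" for u v
    using hdist_eq_rdist[OF sub, of "f u" "f v"] img that
      rdist_bij_betw[OF f(1) edge_subset f(2) that connected[OF that]] by simp
  obtain x where x: "\<And>u. u \<in> verts G \<Longrightarrow> x u > 0"
    "\<And>u. u \<in> verts G \<Longrightarrow>
       (\<Sum>v\<in>verts G. real (rdist (edges G) u v) * x v) = dist_spectral_radius G * x u"
    "\<And>y. qform (verts G) (\<lambda>u v. real (rdist (edges G) u v)) y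
       \<le> dist_spectral_radius G * (\<Sum>v\<in>verts G. (y v)\<^sup>2)"
    using hypertree_perron[OF G card] by blast
  obtain w where w: "w \<in> verts G" using card by fastforce
  show ?thesis
  proof (rule dist_spectral_radius_eqI[where x = "x \<circ> ?g" and w = "f w"])
    show "finite (verts H)" using finite_V img by simp
    show "f w \<in> verts H" "(x \<circ> ?g) (f w) \<noteq> 0" using w img g x(1)[OF w] by auto
    fix u assume "u \<in> verts H"
    then obtain u' where u': "u' \<in> verts G" "u = f u'" using img by blast
    have "(\<Sum>v\<in>verts H. real (hdist H u v) * (x \<circ> ?g) v) =
        (\<Sum>v\<in>verts G. real (hdist H u (f v)) * (x \<circ> ?g) (f v))"
      by (rule sum.reindex_bij_betw[OF f(1), symmetric])
    also have "\<dots> = (\<Sum>v\<in>verts G. real (rdist (edges G) u' v) * x v)"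
      using u' by (intro sum.cong) (auto simp: d g)
    finally show "(\<Sum>v\<in>verts H. real (hdist H u v) * (x \<circ> ?g) v) = dist_spectral_radius G * (x \<circ> ?g) u"
      using x(2) u' g by simp
  next
    fix y
    have "qform (verts H) (\<lambda>u v. real (hdist H u v)) y =
        qform (verts G) (\<lambda>u v. real (rdist (edges G) u v)) (y \<circ> f)"
      by (rule qform_bij_betw[OF f(1)]) (simp add: d)
    also have "\<dots> \<le> dist_spectral_radius G * (\<Sum>v\<in>verts G. (y (f v))\<^sup>2)"
      using x(3)[of "y \<circ> f"] by simp
    also have "(\<Sum>v\<in>verts G. (y (f v))\<^sup>2) = (\<Sum>v\<in>verts H. (y v)\<^sup>2)"
      by (rule sum.reindex_bij_betw[OF f(1)])
    finally show "qform (verts H) (\<lambda>u v. real (hdist H u v)) y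
        \<le> dist_spectral_radius G * (\<Sum>v\<in>verts H. (y v)\<^sup>2)" .
  qed
qed

section \<open>The distance spectral radius and moving an edge\<close>

text \<open>Only distances between \<open>B\<close> and its complement change, by an amount
  independent of the vertex outside \<open>B\<close>, so the sum factors. The 2 counts both orders
  of a pair.\<close>

lemma (in edge_move) qform_move:
  "qform V (\<lambda>v w. real (rdist E' v w)) x - qform V (\<lambda>v w. real (rdist E v w)) x =
     2 * (\<Sum>v\<in>V - B. x v) *
       ((\<Sum>y\<in>B. x y * real (rdist E a y)) - (\<Sum>y\<in>B. x y * real (rdist E u y)))"
proof -
  define \<delta> where "\<delta> = (\<lambda>v w. (real (rdist E' v w) - real (rdist E v w)) * x v * x w)"
  let ?S = "(\<Sum>y\<in>B. x y * real (rdist E a y)) - (\<Sum>y\<in>B. x y * real (rdist E u y))"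
  have split: "sum g V = sum g (V - B) + sum g B" for g :: "'a \<Rightarrow> real"
    using sum.subset_diff[OF B_subset finite_V] .
  have old: "rdist E v y = rdist E v u + rdist E u y" if "v \<in> V - B" "y \<in> B" for v y
    using rdist_branch[OF f u that(2), of v] that(1) by (simp add: rdist_sym)
  have across: "\<delta> v y = x v * (x y * real (rdist E a y) - x y * real (rdist E u y))"
    if "v \<in> V - B" "y \<in> B" for v y
    unfolding \<delta>_def rdist_move_across[OF that] old[OF that] by (simp add: algebra_simps)
  have sym: "\<delta> v w = \<delta> w v" for v w
    by (simp add: \<delta>_def rdist_sym[of _ v w])
  have "(\<Sum>v\<in>V - B. \<Sum>w\<in>V. \<delta> v w) = (\<Sum>v\<in>V - B. x v * ?S)"
  proof (intro sum.cong refl)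
    fix v assume v: "v \<in> V - B"
    have "(\<Sum>w\<in>V - B. \<delta> v w) = 0"
      using v rdist_move_outside by (simp add: \<delta>_def)
    then show "(\<Sum>w\<in>V. \<delta> v w) = x v * ?S"
      using v by (simp add: split across sum_subtractf right_diff_distrib flip: sum_distrib_left)
  qed
  moreover have "(\<Sum>v\<in>B. \<Sum>w\<in>V. \<delta> v w) = (\<Sum>v\<in>V - B. x v * ?S)"
  proof -
    have "(\<Sum>v\<in>B. \<Sum>w\<in>V. \<delta> v w) = (\<Sum>v\<in>B. \<Sum>w\<in>V - B. \<delta> v w)"
    proof (rule sum.cong[OF refl])
      fix v assume "v \<in> B"
      then have "(\<Sum>w\<in>B. \<delta> v w) = 0"
        using rdist_move_inside by (simp add: \<delta>_def)
      then show "(\<Sum>w\<in>V. \<delta> v w) = (\<Sum>w\<in>V - B. \<delta> v w)" by (simp add: split)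
    qed
    also have "\<dots> = (\<Sum>w\<in>V - B. \<Sum>v\<in>B. \<delta> w v)"
      by (subst sum.swap) (simp add: sym)
    also have "\<dots> = (\<Sum>v\<in>V - B. x v * ?S)"
      by (intro sum.cong refl)
        (simp add: across sum_subtractf right_diff_distrib flip: sum_distrib_left)
    finally show ?thesis .
  qed
  ultimately have "(\<Sum>v\<in>V. \<Sum>w\<in>V. \<delta> v w) = 2 * (\<Sum>v\<in>V - B. x v) * ?S"
    by (subst split) (simp flip: sum_distrib_right)
  moreover have "(\<Sum>v\<in>V. \<Sum>w\<in>V. \<delta> v w) =
      qform V (\<lambda>v w. real (rdist E' v w)) x - qform V (\<lambda>v w. real (rdist E v w)) x"
    by (simp add: \<delta>_def qform_def sum_subtractf left_diff_distrib)
  ultimately show ?thesis by simp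
qed

lemma (in edge_move) card_move: "card f' = card f"
proof -
  have "a \<notin> f - {u}" using a f_B by blast
  moreover have "finite f" using f edge_subset finite_V finite_subset by metis
  ultimately show ?thesis using u by (metis card_insert_disjoint finite_Diff insert_Diff_single card.remove insert_absorb)
qed

section \<open>Local structure forced by balance\<close>

text \<open>The assumption \<open>balanced\<close> says that moving an edge does not increase the quadratic form
  of the distance matrix at the Perron vector \<open>x\<close>.\<close>

locale balanced_htree = htree +
  fixes x :: "'a \<Rightarrow> real" and r :: real
  assumes edge_other: "e \<in> E \<Longrightarrow> e \<noteq> {v}"
    and pos: "v \<in> V \<Longrightarrow> x v > 0"
    and eigen: "v \<in> V \<Longrightarrow> (\<Sum>y\<in>V. real (rdist E v y) * x y) = r * x v"
    and balanced: "f \<in> E \<Longrightarrow> u \<in> f \<Longrightarrow> a \<in> branch E f u \<Longrightarrow>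
      (\<Sum>y\<in>branch E f u. x y * real (rdist E a y)) \<le> (\<Sum>y\<in>branch E f u. x y * real (rdist E u y))"
begin

lemma other_vertex:
  assumes "e \<in> E" "v \<in> e" obtains w where "w \<in> e" "w \<noteq> v"
  using edge_other[OF assms(1), of v] assms(2) by blast

lemma rdist_edge_triangle:
  assumes "e \<in> E" "v \<in> e" "w \<in> e" "y \<in> V"
  shows "rdist E v y \<le> Suc (rdist E w y)"
proof -
  have "rdist E v y \<le> rdist E v w + rdist E w y"
    using assms edge_in_V connected by (intro rdist_triangle) auto
  then show ?thesis using rdist_edge[OF assms(1-3)] by simp
qed

text \<open>For neighbours \<open>p\<close> on \<open>g\<close> and \<open>q\<close> on
  \<open>h\<close>, distance is midpoint convex along \<open>p\<close>, \<open>u\<close>,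
  \<open>q\<close>, strictly for \<open>y = u\<close>. Weighted summation contradicts
  \<open>balanced\<close> for the moves to \<open>p\<close> and \<open>q\<close>.\<close>

lemma no_three_edges_at_vertex:
  assumes fgh: "f \<in> E" "g \<in> E" "h \<in> E" and neq: "f \<noteq> g" "f \<noteq> h" "g \<noteq> h"
    and u: "u \<in> f" "u \<in> g" "u \<in> h"
  shows False
proof -
  let ?B = "branch E f u"
  have uV: "u \<in> V" using fgh u edge_in_V by blast
  have BV: "?B \<subseteq> V" using branch_subset uV .
  then have finB: "finite ?B" using finite_V finite_subset by blast
  obtain p where p: "p \<in> g" "p \<noteq> u" using other_vertex fgh u by blast
  obtain q where q: "q \<in> h" "q \<noteq> u" using other_vertex fgh u by blast
  have pB: "p \<in> ?B" using branch_subset_branch[of g f u p] branch_refl[of p E g] fgh neq u p by blast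
  have qB: "q \<in> ?B" using branch_subset_branch[of h f u q] branch_refl[of q E h] fgh neq u q by blast
  \<comment> \<open>Seen from \<open>u\<close>, the vertex \<open>y\<close> cannot lie beyond both
    \<open>g\<close> and \<open>h\<close>; so \<open>p\<close> or \<open>q\<close> is one step
    farther from \<open>y\<close> than \<open>u\<close> is, and the other is at most one step
    nearer.\<close>
  have convex: "2 * rdist E u y \<le> rdist E p y + rdist E q y" if y: "y \<in> ?B" for y
  proof -
    have yV: "y \<in> V" using y BV by blast
    have up: "rdist E u y \<le> Suc (rdist E p y)" "rdist E u y \<le> Suc (rdist E q y)"
      using rdist_edge_triangle fgh u p q yV by blast+
    show ?thesis
    proof (cases "y \<in> branch E g u")
      case True
      then have "rdist E p y = Suc (rdist E u y)"
        using rdist_other_branch[of g p u y] fgh u p by auto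
      then show ?thesis using up by simp
    next
      case False
      obtain w where w: "w \<in> g" "y \<in> branch E g w" using branch_cover fgh yV by blast
      then have "w \<noteq> u" using False by blast
      then have "y \<in> branch E h u"
        using branch_subset_branch[of g h u w] fgh neq u w by blast
      then have "rdist E q y = Suc (rdist E u y)"
        using rdist_other_branch[of h q u y] fgh u q by auto
      then show ?thesis using up by simp
    qed
  qed
  have "(\<Sum>y\<in>?B. x y * real (2 * rdist E u y)) < (\<Sum>y\<in>?B. x y * real (rdist E p y + rdist E q y))"
  proof (rule sum_strict_mono_ex1[OF finB])
    show "\<forall>y\<in>?B. x y * real (2 * rdist E u y) \<le> x y * real (rdist E p y + rdist E q y)"
      using convex pos BV by (intro ballI mult_left_mono of_nat_mono) (auto intro: less_imp_le)
    have "rdist E p u = 1" using rdist_edge_eq fgh u p by metis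
    then show "\<exists>y\<in>?B. x y * real (2 * rdist E u y) < x y * real (rdist E p y + rdist E q y)"
      using pos[OF uV] by (intro bexI[of _ u]) auto
  qed
  also have "\<dots> = (\<Sum>y\<in>?B. x y * real (rdist E p y)) + (\<Sum>y\<in>?B. x y * real (rdist E q y))"
    by (simp add: distrib_left sum.distrib)
  also have "\<dots> \<le> 2 * (\<Sum>y\<in>?B. x y * real (rdist E u y))"
    using balanced[OF fgh(1) u(1) pB] balanced[OF fgh(1) u(1) qB] by simp
  also have "\<dots> = (\<Sum>y\<in>?B. x y * real (2 * rdist E u y))"
    by (simp add: sum_distrib_left mult_ac)
  finally show False by simp
qed

lemma eigenvalue_nonneg: "r \<ge> 0"
proof -
  obtain v where v: "v \<in> V" using V_nonempty by blast
  have "(\<Sum>y\<in>V. real (rdist E v y) * x y) \<ge> 0"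
    using pos by (intro sum_nonneg mult_nonneg_nonneg) (auto intro: less_imp_le)
  then show ?thesis using eigen[OF v] pos[OF v] by (simp add: zero_le_mult_iff)
qed

lemma sum_indicator:
  assumes "finite B" "A \<subseteq> B"
  shows "(\<Sum>y\<in>B. x y * (if y \<in> A then c else 0)) = c * (\<Sum>y\<in>A. x y)"
proof -
  have "(\<Sum>y\<in>A. x y * c) = (\<Sum>y\<in>B. x y * (if y \<in> A then c else 0))"
    using assms by (intro sum.mono_neutral_cong_left) auto
  then show ?thesis by (simp add: sum_distrib_left mult.commute)
qed

lemma no_three_branches_aux:
  assumes e: "e \<in> E" "u1 \<in> e" "u2 \<in> e" "u3 \<in> e" "u1 \<noteq> u2" "u1 \<noteq> u3" "u2 \<noteq> u3"
    and g: "g \<in> E" "g \<noteq> e" "u2 \<in> g" and f: "f \<in> E" "f \<noteq> e" "u3 \<in> f"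
    and le: "(\<Sum>y\<in>branch E e u2. x y) \<le> (\<Sum>y\<in>branch E e u1. x y)"
  shows False
proof -
  let ?d = "\<lambda>v w. real (rdist E v w)"
  let ?B = "branch E f u3" and ?B1 = "branch E e u1" and ?B2 = "branch E e u2"
  have uV: "u1 \<in> V" "u2 \<in> V" "u3 \<in> V" using e edge_in_V by blast+
  have BV: "?B \<subseteq> V" "?B1 \<subseteq> V" "?B2 \<subseteq> V" using branch_subset uV by auto
  then have fin: "finite ?B" "finite ?B2" using finite_V finite_subset by blast+
  have sub: "?B1 \<subseteq> ?B" "?B2 \<subseteq> ?B"
    using branch_subset_branch[of e f u3] e f by metis+
  define p where "p = Max (rdist E u2 ` ?B2)"
  have "p \<in> rdist E u2 ` ?B2"
  proof -
    have "?B2 \<noteq> {}" using branch_refl[of u2 E e] by blast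
    then show ?thesis unfolding p_def using fin by (intro Max_in) auto
  qed
  then obtain a where a: "a \<in> ?B2" "rdist E u2 a = p" by auto
  have p_max: "rdist E u2 y \<le> p" if "y \<in> ?B2" for y
    unfolding p_def using fin that by auto
  \<comment> \<open>The further edge at \<open>u2\<close> yields a vertex at distance 1 in its
    branch, so \<open>p \<ge> 1\<close>; the signs of \<open>p - 1\<close> and
    \<open>2 * p - 1\<close> below depend on this.\<close>
  obtain w where w: "w \<in> g" "w \<noteq> u2" using other_vertex g by blast
  then have "w \<in> ?B2" using branch_subset_branch[of g e u2 w] branch_refl[of w E g] e g by blast
  moreover have "rdist E u2 w = 1" using rdist_edge_eq g w by metis
  ultimately have p1: "p \<ge> 1" using p_max by force
  have aV: "a \<in> V" and aB: "a \<in> ?B" using a BV sub by auto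
  have disj: "y \<notin> ?B2" if "y \<in> ?B1" for y using branch_unique[of e u1 u2 y] e that by blast
  have u3: "u3 \<notin> ?B1" "u3 \<notin> ?B2" "u3 \<in> ?B" using edge_branch e by auto
  have a_ne: "a \<noteq> u2" "a \<noteq> u3" "a \<notin> ?B1" "u2 \<notin> ?B1" using a p1 u3 disj edge_branch e by auto
  have d_aV: "rdist E a y = p + rdist E u2 y" if "y \<in> V" "y \<notin> ?B2" for y
    using rdist_branch[OF e(1) e(3) a(1) that] a(2) by (simp add: rdist_sym)
  have d1: "rdist E u2 y = Suc (rdist E u1 y)" "rdist E u3 y = Suc (rdist E u1 y)" if "y \<in> ?B1" for y
    using rdist_other_branch[of e _ u1 y] e that by auto
  have d2: "rdist E u3 y = Suc (rdist E u2 y)" if "y \<in> ?B2" for y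
    using rdist_other_branch[of e u3 u2 y] e that by auto
  have d23: "rdist E u2 u3 = 1" "rdist E u3 u2 = 1" using rdist_edge_eq[OF e(1)] e by auto
  have ne: "rdist E v y \<ge> 1" if "v \<in> V" "y \<in> V" "v \<noteq> y" for v y
    using rdist_eq_0[OF connected[OF that(1,2)]] that by simp

  \<comment> \<open>Lower bound for the distance from \<open>a\<close> minus that from
    \<open>u3\<close>. It is \<open>p\<close> on \<open>?B1\<close> and \<open>p + 1\<close> at
    \<open>u3\<close>. On \<open>?B2\<close> it is \<open>- p\<close>, as \<open>u3\<close> is at
    most \<open>p + 1\<close> away and \<open>a\<close> at least 1, except for
    \<open>- p - 1\<close> at \<open>a\<close> and \<open>p - 1\<close> at \<open>u2\<close>.
    Elsewhere it is 0.\<close>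
  define L where "L = (\<lambda>y. (if y \<in> ?B1 then real p else 0) - (if y \<in> ?B2 then real p else 0)
     + (if y \<in> {u3} then real p + 1 else 0) - (if y \<in> {a} then 1 else 0)
     + (if y \<in> {u2} then 2 * real p - 1 else 0))"
  have L: "L y \<le> ?d a y - ?d u3 y" if y: "y \<in> ?B" for y
  proof -
    have yV: "y \<in> V" using y BV by blast
    consider "y \<in> ?B1" | "y = a" | "y = u2" | "y \<in> ?B2" "y \<noteq> a" "y \<noteq> u2" | "y = u3"
      | "y \<notin> ?B1" "y \<notin> ?B2" "y \<noteq> u3" by blast
    then show ?thesis
    proof cases
      case 1
      then show ?thesis
        using d_aV[OF yV disj[OF 1]] d1[OF 1] u3 a_ne disj[OF 1] by (auto simp: L_def)
    next
      case 2
      then show ?thesis using a a_ne d2[OF a(1)] by (auto simp: L_def)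
    next
      case 3
      then show ?thesis using a a_ne d23 e(7) by (auto simp: L_def rdist_sym)
    next
      case 4
      then have "y \<notin> ?B1" "y \<noteq> u3" using disj u3 by auto
      then show ?thesis
        using 4 p_max[OF 4(1)] d2[OF 4(1)] ne[OF aV yV] by (auto simp: L_def)
    next
      case 5
      then show ?thesis using u3 a_ne e(7) d_aV[OF uV(3) u3(2)] d23 by (auto simp: L_def)
    next
      case 6
      then have "y \<noteq> a" "y \<noteq> u2" using a by auto
      then have "L y = 0" using 6 by (simp add: L_def)
      moreover have "rdist E u3 y \<le> Suc (rdist E u2 y)" using rdist_edge_triangle e yV by blast
      ultimately show ?thesis using d_aV[OF yV 6(2)] p1 by simp
    qed
  qed
  have "(\<Sum>y\<in>?B. x y * L y) \<le> (\<Sum>y\<in>?B. x y * (?d a y - ?d u3 y))"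
    using L pos BV by (intro sum_mono mult_left_mono) (auto intro: less_imp_le)
  also have "\<dots> \<le> 0"
    using balanced[OF f(1,3) aB] by (simp add: right_diff_distrib sum_subtractf)
  finally have "(\<Sum>y\<in>?B. x y * L y) \<le> 0" .
  moreover have "(\<Sum>y\<in>?B. x y * L y) = real p * (\<Sum>y\<in>?B1. x y) - real p * (\<Sum>y\<in>?B2. x y)
      + (real p + 1) * x u3 - x a + (2 * real p - 1) * x u2"
  proof -
    have "{u3} \<subseteq> ?B" "{a} \<subseteq> ?B" "{u2} \<subseteq> ?B" using u3 aB sub(2) branch_refl[of u2 E e] by auto
    note sum_indicator[OF fin(1) this(1)] sum_indicator[OF fin(1) this(2)]
      sum_indicator[OF fin(1) this(3)] sum_indicator[OF fin(1) sub(1)] sum_indicator[OF fin(1) sub(2)]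
    then show ?thesis
      unfolding L_def distrib_left right_diff_distrib sum.distrib sum_subtractf by simp
  qed
  ultimately have key: "(real p + 1) * x u3 + (2 * real p - 1) * x u2 - x a \<le> 0"
    using mult_left_mono[OF le, of "real p"] by simp

  \<comment> \<open>Combines the rows \<open>u3\<close>, \<open>u2\<close> and \<open>a\<close> with
    the coefficients of \<open>key\<close>, so that by the eigenvalue equation the weighted sum is
    \<open>r\<close> times a nonpositive number. The value at \<open>u3\<close> is
    \<open>p - 2\<close>, whence the \<open>- 1\<close> in the lower bound \<open>l\<close>.\<close>
  define c where "c = (\<lambda>y. (real p + 1) * ?d u3 y + (2 * real p - 1) * ?d u2 y - ?d a y)"
  define l where "l = (\<lambda>y. (if y \<in> {a} then 1 else 0) + (if y \<in> {u2} then 1 else 0)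
     - (if y \<in> {u3} then 1 else 0 :: real))"
  have "l y \<le> c y" if y: "y \<in> V" for y
  proof -
    consider "y = a" | "y = u2" | "y = u3" | "y \<noteq> a" "y \<noteq> u2" "y \<noteq> u3" by blast
    then show ?thesis
    proof cases
      case 1
      have "1 * 1 \<le> (real p + 1) * (real p + 1)" "0 \<le> (2 * real p - 1) * real p"
        using p1 by (intro mult_mono mult_nonneg_nonneg; simp)+
      then show ?thesis using 1 a_ne a d2[OF a(1)] by (simp add: l_def c_def add.commute)
    next
      case 2
      then show ?thesis using a_ne a e(7) d23 by (simp add: l_def c_def rdist_sym)
    next
      case 3
      then show ?thesis
        using a_ne e(7) d23 d_aV[OF uV(3) u3(2)] p1 by (simp add: l_def c_def)
    next
      case 4
      have "rdist E a y \<le> rdist E a u2 + rdist E u2 y"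
        using aV uV y connected by (intro rdist_triangle) auto
      then have "?d a y \<le> real p + ?d u2 y" using a(2) by (simp add: rdist_sym)
      then have "?d a y \<le> (real p + 1) * 1 + 1 * ?d u2 y" by simp
      also have "(real p + 1) * 1 \<le> (real p + 1) * ?d u3 y"
        using ne[OF uV(3) y] 4 by (intro mult_left_mono) auto
      also have "1 * ?d u2 y \<le> (2 * real p - 1) * ?d u2 y"
        using p1 by (intro mult_right_mono) auto
      finally have "c y \<ge> 0" by (simp add: c_def)
      then show ?thesis using 4 by (simp add: l_def)
    qed
  qed
  then have "(\<Sum>y\<in>V. x y * l y) \<le> (\<Sum>y\<in>V. x y * c y)"
    using pos by (intro sum_mono mult_left_mono) (auto intro: less_imp_le)
  also have "(\<Sum>y\<in>V. x y * c y) = (real p + 1) * (\<Sum>y\<in>V. ?d u3 y * x y)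
      + (2 * real p - 1) * (\<Sum>y\<in>V. ?d u2 y * x y) - (\<Sum>y\<in>V. ?d a y * x y)"
    by (simp add: c_def algebra_simps sum.distrib sum_subtractf sum_distrib_left)
  also have "\<dots> = r * ((real p + 1) * x u3 + (2 * real p - 1) * x u2 - x a)"
    using eigen uV aV by (simp add: algebra_simps)
  also have "\<dots> \<le> 0"
    using key eigenvalue_nonneg by (simp add: mult_nonneg_nonpos)
  also have "(\<Sum>y\<in>V. x y * l y) = x a + x u2 - x u3"
    using sum_indicator[OF finite_V, of "{a}" 1] sum_indicator[OF finite_V, of "{u2}" 1]
      sum_indicator[OF finite_V, of "{u3}" 1] aV uV
    unfolding l_def distrib_left right_diff_distrib sum.distrib sum_subtractf by simp
  finally have "x a + x u2 \<le> x u3" by simp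
  \<comment> \<open>Now \<open>key\<close> gives \<open>x a \<ge> x u3\<close>, which leaves no room
    for the positive \<open>x u2\<close>.\<close>
  moreover have "1 * x u3 \<le> (real p + 1) * x u3" "0 \<le> (2 * real p - 1) * x u2"
    using pos uV p1 by (intro mult_right_mono mult_nonneg_nonneg; simp add: less_imp_le)+
  ultimately show False using key pos[OF uV(2)] by simp
qed

lemma no_three_branches:
  assumes "e \<in> E" "u1 \<in> e" "u2 \<in> e" "u3 \<in> e" "u1 \<noteq> u2" "u1 \<noteq> u3" "u2 \<noteq> u3"
    and "g1 \<in> E" "g1 \<noteq> e" "u1 \<in> g1" and "g2 \<in> E" "g2 \<noteq> e" "u2 \<in> g2"
    and "g3 \<in> E" "g3 \<noteq> e" "u3 \<in> g3"
  shows False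
proof (cases "(\<Sum>y\<in>branch E e u2. x y) \<le> (\<Sum>y\<in>branch E e u1. x y)")
  case True
  then show False using no_three_branches_aux[of e u1 u2 u3 g2 g3] assms by blast
next
  case False
  then have "(\<Sum>y\<in>branch E e u1. x y) \<le> (\<Sum>y\<in>branch E e u2. x y)" by simp
  then show False using no_three_branches_aux[of e u2 u1 u3 g1 g3] assms by metis
qed

end

section \<open>Extremal hypertrees\<close>

text \<open>Vertices in no edge are included: the one left after the last edge is removed must
  qualify in the labelling induction.\<close>

definition pendant :: "'a set set \<Rightarrow> 'a \<Rightarrow> bool" where
  "pendant E v \<longleftrightarrow> (\<forall>e\<in>E. \<forall>f\<in>E. v \<in> e \<and> v \<in> f \<longrightarrow> e = f)"

text \<open>The exceptional \<open>w\<close> is where the edge at \<open>r\<close> may be attached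
  to the rest, so that \<open>remove_end_edge\<close> can strip this edge off.\<close>

definition end_vertex :: "'a set set \<Rightarrow> 'a \<Rightarrow> bool" where
  "end_vertex E r \<longleftrightarrow> pendant E r \<and> (\<forall>e\<in>E. r \<in> e \<longrightarrow> (\<exists>w. \<forall>v\<in>e - {w}. pendant E v))"

lemma pendant_mono: "pendant E v \<Longrightarrow> F \<subseteq> E \<Longrightarrow> pendant F v"
  by (auto simp: pendant_def)

context htree
begin

lemma finite_E: "finite E"
  using finite_V edge_subset by (metis PowI finite_Pow_iff finite_subset subsetI)

lemma edge_at_vertex:
  assumes "r \<in> V" "v \<in> V" "v \<noteq> r"
  obtains e where "e \<in> E" "r \<in> e"
proof -
  have "conn E r v" using assms connected by blast
  then have "v = r \<or> (\<exists>e\<in>E. r \<in> e)"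
    by (induction rule: conn_induct) auto
  then show ?thesis using assms that by blast
qed

text \<open>A vertex at maximal distance from a fixed root is an end vertex.\<close>

lemma ex_end_vertex:
  assumes other: "\<And>e v. e \<in> E \<Longrightarrow> e \<noteq> {v}"
  shows "\<exists>r\<in>V. end_vertex E r"
proof -
  obtain s where s: "s \<in> V" using V_nonempty by blast
  define M where "M = Max ((\<lambda>v. rdist E v s) ` V)"
  have "M \<in> (\<lambda>v. rdist E v s) ` V"
    unfolding M_def using finite_V V_nonempty by (intro Max_in) auto
  then obtain r where r: "r \<in> V" "rdist E r s = M" by blast
  have M: "rdist E v s \<le> M" if "v \<in> V" for v
    unfolding M_def using finite_V that by auto
  have far: "s \<notin> branch E e z" if z: "rdist E z s = M" "e \<in> E" "z \<in> e" for z e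
  proof
    assume "s \<in> branch E e z"
    moreover obtain v where v: "v \<in> e" "v \<noteq> z" using other[OF z(2), of z] z(3) by blast
    ultimately have "rdist E v s = Suc M"
      using rdist_other_branch[of e v z s] z by auto
    then show False using M[of v] v z edge_in_V by force
  qed
  \<comment> \<open>Needed for every vertex at distance \<open>M\<close>: all vertices of the edge
    at \<open>r\<close> except the one towards \<open>s\<close> are equally far away.\<close>
  have pend: "pendant E z" if z: "rdist E z s = M" for z
    unfolding pendant_def
  proof (intro ballI impI, rule ccontr)
    fix e f assume ef: "e \<in> E" "f \<in> E" "z \<in> e \<and> z \<in> f" "e \<noteq> f"
    obtain w where w: "w \<in> e" "s \<in> branch E e w" using branch_cover ef(1) s by blast
    then have "w \<noteq> z" using far[OF z ef(1)] ef by blast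
    then have "s \<in> branch E f z" using branch_subset_branch[of e f z w] ef w by blast
    then show False using far[OF z ef(2)] ef by blast
  qed
  have "\<exists>w. \<forall>v\<in>e - {w}. pendant E v" if e: "e \<in> E" "r \<in> e" for e
  proof -
    obtain w where w: "w \<in> e" "s \<in> branch E e w" using branch_cover e s by blast
    then have "w \<noteq> r" using far[OF r(2) e] by blast
    have d: "rdist E v s = Suc (rdist E w s)" if "v \<in> e" "v \<noteq> w" for v
      using rdist_other_branch[of e v w s] e w that by auto
    have "pendant E v" if "v \<in> e - {w}" for v
      using d[of v] d[of r] that r e \<open>w \<noteq> r\<close> by (intro pend) auto
    then show ?thesis by blast
  qed
  then show ?thesis using r pend unfolding end_vertex_def by blast
qed

text \<open>No other edge meets \<open>e - {w}\<close>, so contracting \<open>e\<close> to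
  \<open>w\<close> preserves connectivity of the rest.\<close>

lemma remove_end_edge:
  assumes e: "e \<in> E" "w \<in> e" and pend: "\<And>v. v \<in> e \<Longrightarrow> v \<noteq> w \<Longrightarrow> pendant E v"
  shows "htree (V - (e - {w})) (E - {e})"
proof
  have disj: "h \<inter> (e - {w}) = {}" if "h \<in> E - {e}" for h
    using pend that e(1) unfolding pendant_def by blast
  show "finite (V - (e - {w}))" using finite_V by simp
  show "V - (e - {w}) \<noteq> {}" using e edge_in_V by blast
  show "h \<noteq> {}" if "h \<in> E - {e}" for h using that edge_nonempty by blast
  show "h \<subseteq> V - (e - {w})" if "h \<in> E - {e}" for h using that edge_subset disj by blast
  show "conn (E - {e}) u v" if uv: "u \<in> V - (e - {w})" "v \<in> V - (e - {w})" for u v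
  proof -
    define \<phi> where "\<phi> = (\<lambda>z. if z \<in> e then w else z)"
    have "conn (E - {e}) (\<phi> u) (\<phi> v)"
    proof (rule conn_map[where \<phi> = \<phi>])
      show "conn E u v" using connected uv by blast
      fix h assume h: "h \<in> E"
      show "(\<exists>c. \<phi> ` h \<subseteq> {c}) \<or> (\<exists>e'\<in>E - {e}. \<phi> ` h \<subseteq> e')"
      proof (cases "h = e")
        case True
        then show ?thesis by (intro disjI1 exI[of _ w]) (auto simp: \<phi>_def)
      next
        case False
        then have "\<phi> ` h \<subseteq> h" using disj[of h] h by (auto simp: \<phi>_def)
        then show ?thesis using h False by blast
      qed
    qed
    moreover have "\<phi> u = u" "\<phi> v = v" using uv by (auto simp: \<phi>_def)
    ultimately show ?thesis by simp
  qed
  show "u = v" if "h \<in> E - {e}" "u \<in> h" "v \<in> h" "conn (E - {e} - {h}) u v" for h u v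
    using that bridge[of h u v] conn_mono[of "E - {e} - {h}" u v "E - {h}"] by blast
qed

end

text \<open>Induction on the number of edges, stripping the edge at \<open>r\<close>. Its attachment
  vertex \<open>w\<close> is an end vertex of the rest; since an end vertex is made to carry the
  last label, the stripped edge can be appended at \<open>w\<close>.\<close>

lemma ex_loose_path_labelling:
  assumes "htree V E" "card E = m" and k: "k \<ge> 2" and unif: "\<And>e. e \<in> E \<Longrightarrow> card e = k"
    and deg: "\<And>v e f g. e \<in> E \<Longrightarrow> f \<in> E \<Longrightarrow> g \<in> E \<Longrightarrow> v \<in> e \<Longrightarrow> v \<in> f \<Longrightarrow> v \<in> g \<Longrightarrow>
       e = f \<or> e = g \<or> f = g"
    and branching: "\<And>e u v w. e \<in> E \<Longrightarrow> u \<in> e \<Longrightarrow> v \<in> e \<Longrightarrow> w \<in> e \<Longrightarrow>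
       u \<noteq> v \<Longrightarrow> u \<noteq> w \<Longrightarrow> v \<noteq> w \<Longrightarrow> pendant E u \<or> pendant E v \<or> pendant E w"
    and r: "r \<in> V" "end_vertex E r"
  shows "\<exists>\<phi>. bij_betw \<phi> V {1..1 + (k - 1) * m} \<and>
     (\<lambda>e. \<phi> ` e) ` E = (\<lambda>i. {(i - 1) * (k - 1) + 1 .. (i - 1) * (k - 1) + k}) ` {1..m} \<and>
     \<phi> r = 1 + (k - 1) * m"
  using assms(1,2) unif deg branching r
proof (induction m arbitrary: V E r)
  case 0
  interpret htree V E by fact
  have "E = {}" using finite_E 0 by simp
  then have "V = {r}" using edge_at_vertex 0 by blast
  then show ?case using \<open>E = {}\<close> by (intro exI[of _ "\<lambda>_. 1"]) (auto simp: bij_betw_def)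
next
  case (Suc m)
  interpret htree V E by fact
  note unif = Suc.prems(3) and deg = Suc.prems(4) and branching = Suc.prems(5) and r = Suc.prems(6,7)
  have fin_e: "finite e" if "e \<in> E" for e using edge_subset[OF that] finite_V finite_subset by blast
  have ex_other: "\<exists>w\<in>e. w \<noteq> v" if "e \<in> E" for e v
  proof (rule ccontr)
    assume "\<not> ?thesis"
    then have "e \<subseteq> {v}" by blast
    then have "card e \<le> 1" using card_mono[of "{v}" e] by simp
    then show False using unif[OF that] k by simp
  qed
  obtain h where "h \<in> E" using Suc.prems(2) by fastforce
  then obtain v where "v \<in> V" "v \<noteq> r" using ex_other edge_in_V by blast
  then obtain e where e: "e \<in> E" "r \<in> e" using edge_at_vertex r by metis
  obtain w0 where w0: "\<And>v. v \<in> e \<Longrightarrow> v \<noteq> w0 \<Longrightarrow> pendant E v"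
    using r e unfolding end_vertex_def by blast
  have "pendant E r" using r by (simp add: end_vertex_def)
  obtain w where w: "w \<in> e" "w \<noteq> r" and pend: "\<And>v. v \<in> e \<Longrightarrow> v \<noteq> w \<Longrightarrow> pendant E v"
  \<comment> \<open>If \<open>w0\<close> is no vertex of \<open>e\<close> other than
    \<open>r\<close>, all of \<open>e\<close> is pendant and any of its vertices except
    \<open>r\<close> can serve as \<open>w\<close>.\<close>
  proof (cases "w0 \<in> e \<and> w0 \<noteq> r")
    case True
    then show ?thesis using w0 that by blast
  next
    case False
    then have "pendant E v" if "v \<in> e" for v
      using w0 that \<open>pendant E r\<close> by blast
    moreover obtain w where "w \<in> e" "w \<noteq> r" using ex_other e by blast
    ultimately show ?thesis using that by blast
  qed
  define V1 where "V1 = V - (e - {w})"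
  define E1 where "E1 = E - {e}"
  define N where "N = 1 + (k - 1) * m"
  have ht: "htree V1 E1" unfolding V1_def E1_def using e w pend by (intro remove_end_edge)
  then interpret H: htree V1 E1 .
  have w1: "pendant E1 w"
    using deg e w unfolding pendant_def E1_def by blast
  have "end_vertex E1 w"
    unfolding end_vertex_def
  proof (intro conjI ballI impI w1)
    fix h assume h: "h \<in> E1" "w \<in> h"
    \<comment> \<open>Two vertices of \<open>h\<close> that are not pendant would, together with
      \<open>w\<close> on both \<open>e\<close> and \<open>h\<close>, make three in
      \<open>E\<close>, against \<open>branching\<close>.\<close>
    show "\<exists>w'. \<forall>v\<in>h - {w'}. pendant E1 v"
    proof (rule ccontr)
      assume no: "\<not> ?thesis"
      then obtain v1 where v1: "v1 \<in> h" "v1 \<noteq> w" "\<not> pendant E1 v1" by blast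
      from no obtain v2 where v2: "v2 \<in> h" "v2 \<noteq> v1" "\<not> pendant E1 v2" by blast
      have "v2 \<noteq> w" using w1 v2 by blast
      moreover have "\<not> pendant E w" using h e w unfolding pendant_def E1_def by blast
      moreover have "\<not> pendant E v1" "\<not> pendant E v2"
        using v1 v2 pendant_mono[of E _ E1] E1_def by blast+
      ultimately show False using branching[of h v1 v2 w] h v1 v2 E1_def by blast
    qed
  qed
  moreover have "card E1 = m" using Suc.prems(2) finite_E e by (simp add: E1_def)
  moreover have "w \<in> V1" using w e edge_in_V by (auto simp: V1_def)
  moreover have "pendant E1 x \<or> pendant E1 y \<or> pendant E1 z"
    if "g \<in> E1" "x \<in> g" "y \<in> g" "z \<in> g" "x \<noteq> y" "x \<noteq> z" "y \<noteq> z" for g x y z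
    using branching[of g x y z] that pendant_mono[of E _ E1] unfolding E1_def by blast
  ultimately have "\<exists>\<phi>. bij_betw \<phi> V1 {1..1 + (k - 1) * m} \<and>
     (\<lambda>e. \<phi> ` e) ` E1 = (\<lambda>i. {(i - 1) * (k - 1) + 1 .. (i - 1) * (k - 1) + k}) ` {1..m} \<and>
     \<phi> w = 1 + (k - 1) * m"
    by (intro Suc.IH[OF ht]) (use unif deg in \<open>auto simp: E1_def\<close>)
  then obtain \<phi>1 where \<phi>1: "bij_betw \<phi>1 V1 {1..N}" "\<phi>1 w = N"
    "(\<lambda>e. \<phi>1 ` e) ` E1 = (\<lambda>i. {(i - 1) * (k - 1) + 1 .. (i - 1) * (k - 1) + k}) ` {1..m}"
    unfolding N_def by blast
  have "card (e - {w, r}) = k - 2"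
    using w e unif[OF e(1)] by (subst card_Diff_subset) auto
  then have "card (e - {w, r}) = card {N + 1..<N + k - 1}" using k by simp
  then obtain g where g: "bij_betw g (e - {w, r}) {N + 1..<N + k - 1}"
    using finite_same_card_bij[of "e - {w, r}" "{N + 1..<N + k - 1}"] fin_e[OF e(1)] by auto
  \<comment> \<open>Here \<open>w\<close> keeps \<open>N\<close>, the interior of \<open>e\<close>
    receives \<open>N + 1\<close> to \<open>N + k - 2\<close> (nothing if \<open>k = 2\<close>), and
    \<open>r\<close> receives \<open>N + k - 1\<close>; so \<open>e\<close> becomes the next
    interval.\<close>
  define \<phi> where "\<phi> = (\<lambda>z. if z = r then N + k - 1 else if z \<in> e - {w} then g z else \<phi>1 z)"
  have rV1: "r \<notin> V1" using e w by (auto simp: V1_def)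
  have on_V1: "\<phi> z = \<phi>1 z" if "z \<in> V1" for z
    using that rV1 by (auto simp: \<phi>_def V1_def)
  have b1: "bij_betw \<phi> V1 {1..N}"
    using \<phi>1(1) on_V1 bij_betw_cong[of V1 \<phi> \<phi>1] by blast
  have b2: "bij_betw \<phi> (e - {w, r}) {N + 1..<N + k - 1}"
    using g by (subst bij_betw_cong[of _ _ g]) (auto simp: \<phi>_def)
  have b3: "bij_betw \<phi> {r} {N + k - 1}" by (simp add: \<phi>_def bij_betw_def)
  have "bij_betw \<phi> (V1 \<union> (e - {w, r})) ({1..N} \<union> {N + 1..<N + k - 1})"
    by (rule bij_betw_combine[OF b1 b2]) auto
  then have "bij_betw \<phi> (V1 \<union> (e - {w, r}) \<union> {r}) ({1..N} \<union> {N + 1..<N + k - 1} \<union> {N + k - 1})"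
    by (rule bij_betw_combine[OF _ b3]) (use k in auto)
  moreover have "V1 \<union> (e - {w, r}) \<union> {r} = V"
    using w e edge_in_V by (auto simp: V1_def)
  moreover have "{1..N} \<union> {N + 1..<N + k - 1} \<union> {N + k - 1} = {1..1 + (k - 1) * Suc m}"
    using k by (auto simp: N_def)
  ultimately have bij: "bij_betw \<phi> V {1..1 + (k - 1) * Suc m}" by simp
  have "\<phi> w = N" using \<phi>1(2) w by (simp add: \<phi>_def)
  have "{w} \<union> (e - {w, r}) \<union> {r} = e" using w e by blast
  then have "\<phi> ` e = \<phi> ` {w} \<union> \<phi> ` (e - {w, r}) \<union> \<phi> ` {r}"
    by (simp only: flip: image_Un)
  also have "\<dots> = {N} \<union> {N + 1..<N + k - 1} \<union> {N + k - 1}"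
    unfolding bij_betw_imp_surj_on[OF b2] bij_betw_imp_surj_on[OF b3] by (simp add: \<open>\<phi> w = N\<close>)
  also have "\<dots> = {m * (k - 1) + 1 .. m * (k - 1) + k}"
    using k by (auto simp: N_def mult.commute)
  finally have img_e: "\<phi> ` e = {m * (k - 1) + 1 .. m * (k - 1) + k}" .
  have "\<phi> ` h = \<phi>1 ` h" if "h \<in> E1" for h
    using H.edge_subset[OF that] on_V1 by (intro image_cong) auto
  then have "(\<lambda>e. \<phi> ` e) ` E1 = (\<lambda>e. \<phi>1 ` e) ` E1" by (rule image_cong[OF refl])
  moreover have "E = insert e E1" using e by (auto simp: E1_def)
  ultimately have "(\<lambda>e. \<phi> ` e) ` E =
      (\<lambda>i. {(i - 1) * (k - 1) + 1 .. (i - 1) * (k - 1) + k}) ` {1..Suc m}"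
    using \<phi>1(3) img_e by (simp add: atLeastAtMostSuc_conv)
  moreover have "\<phi> r = 1 + (k - 1) * Suc m" using k by (simp add: \<phi>_def N_def)
  ultimately show ?case using bij by blast
qed

section \<open>Maximisers are loose paths\<close>

lemma isomorphic_loose_path:
  assumes G: "hypertree G" "uniform k G" and k: "k \<ge> 2"
    and deg: "\<And>v e f g. e \<in> edges G \<Longrightarrow> f \<in> edges G \<Longrightarrow> g \<in> edges G \<Longrightarrow>
       v \<in> e \<Longrightarrow> v \<in> f \<Longrightarrow> v \<in> g \<Longrightarrow> e = f \<or> e = g \<or> f = g"
    and branching: "\<And>e u v w. e \<in> edges G \<Longrightarrow> u \<in> e \<Longrightarrow> v \<in> e \<Longrightarrow> w \<in> e \<Longrightarrow>
       u \<noteq> v \<Longrightarrow> u \<noteq> w \<Longrightarrow> v \<noteq> w \<Longrightarrow>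
       pendant (edges G) u \<or> pendant (edges G) v \<or> pendant (edges G) w"
  shows "isomorphic G (loose_path (card (verts G)) k)"
proof -
  have ht: "htree (verts G) (edges G)" using G by (simp add: hypertree_iff_htree)
  then interpret htree "verts G" "edges G" .
  have unif: "card e = k" if "e \<in> edges G" for e using G(2) that by (simp add: uniform_def)
  have "e \<noteq> {v}" if "e \<in> edges G" for e v using unif[OF that] k by auto
  then obtain r where r: "r \<in> verts G" "end_vertex (edges G) r" using ex_end_vertex by blast
  define m where "m = card (edges G)"
  obtain \<phi> where \<phi>: "bij_betw \<phi> (verts G) {1..1 + (k - 1) * m}"
    "(\<lambda>e. \<phi> ` e) ` edges G = (\<lambda>i. {(i - 1) * (k - 1) + 1 .. (i - 1) * (k - 1) + k}) ` {1..m}"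
  proof -
    have "\<exists>\<phi>. bij_betw \<phi> (verts G) {1..1 + (k - 1) * m} \<and>
       (\<lambda>e. \<phi> ` e) ` edges G = (\<lambda>i. {(i - 1) * (k - 1) + 1 .. (i - 1) * (k - 1) + k}) ` {1..m} \<and>
       \<phi> r = 1 + (k - 1) * m"
      by (rule ex_loose_path_labelling[OF ht m_def[symmetric] k _ _ _ r])
        ((rule unif deg branching; assumption)+)
    then show ?thesis using that by blast
  qed
  have n: "card (verts G) = 1 + (k - 1) * m" using bij_betw_same_card[OF \<phi>(1)] by simp
  then have "(card (verts G) - 1) div (k - 1) = m" using k by simp
  then show ?thesis
    unfolding isomorphic_def loose_path_def using \<phi> n by auto
qed

text \<open>The Perron vector of \<open>G\<close> serves as test vector for each moved hypertree. By
  maximality its form value there is at most that for \<open>G\<close>, which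
  \<open>qform_move\<close> turns into \<open>balanced\<close>.\<close>

lemma maximal_isomorphic_loose_path:
  assumes G: "hypertree G" "uniform k G" and k: "k \<ge> 2" and card: "card (verts G) \<ge> 2"
    and max: "\<And>F. hypertree \<lparr>verts = verts G, edges = F\<rparr> \<Longrightarrow> uniform k \<lparr>verts = verts G, edges = F\<rparr> \<Longrightarrow>
       dist_spectral_radius \<lparr>verts = verts G, edges = F\<rparr> \<le> dist_spectral_radius G"
  shows "isomorphic G (loose_path (card (verts G)) k)"
proof -
  interpret htree "verts G" "edges G" using G by (simp add: hypertree_iff_htree)
  have unif: "card e = k" if "e \<in> edges G" for e using G(2) that by (simp add: uniform_def)
  have not_single: "e \<noteq> {v}" if "e \<in> edges G" for e v using unif[OF that] k by auto
  obtain x where x: "\<And>u. u \<in> verts G \<Longrightarrow> x u > 0"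
    "\<And>u. u \<in> verts G \<Longrightarrow>
       (\<Sum>v\<in>verts G. real (rdist (edges G) u v) * x v) = dist_spectral_radius G * x u"
    by (rule hypertree_perron[OF G(1) card]) (rule that)
  have q: "qform (verts G) (\<lambda>u v. real (rdist (edges G) u v)) x =
      dist_spectral_radius G * (\<Sum>v\<in>verts G. (x v)\<^sup>2)"
  proof -
    have "qform (verts G) (\<lambda>u v. real (rdist (edges G) u v)) x =
        (\<Sum>u\<in>verts G. x u * (\<Sum>v\<in>verts G. real (rdist (edges G) u v) * x v))"
      unfolding qform_def sum_distrib_left by (intro sum.cong refl) (simp add: mult_ac)
    then show ?thesis
      by (simp add: x(2) sum_distrib_left power2_eq_square mult.left_commute)
  qed
  interpret balanced_htree "verts G" "edges G" x "dist_spectral_radius G"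
  proof
    fix f u a assume f: "f \<in> edges G" "u \<in> f" "a \<in> branch (edges G) f u"
    let ?B = "branch (edges G) f u"
    interpret edge_move "verts G" "edges G" f u a
      using f not_single by unfold_locales auto
    let ?H = "\<lparr>verts = verts G, edges = E'\<rparr>"
    have H: "hypertree ?H" using htree_move by (simp add: hypertree_iff_htree)
    moreover have "uniform k ?H"
      using unif card_move f by (auto simp: uniform_def move_edge_def)
    ultimately have le: "dist_spectral_radius ?H \<le> dist_spectral_radius G" by (rule max)
    have "qform (verts G) (\<lambda>u v. real (rdist E' u v)) x \<le> dist_spectral_radius ?H * (\<Sum>v\<in>verts G. (x v)\<^sup>2)"
      using hypertree_perron[OF H] card by auto
    also have "\<dots> \<le> dist_spectral_radius G * (\<Sum>v\<in>verts G. (x v)\<^sup>2)"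
      using le by (intro mult_right_mono sum_nonneg) auto
    finally have "2 * (\<Sum>v\<in>verts G - ?B. x v) *
       ((\<Sum>y\<in>?B. x y * real (rdist (edges G) a y)) - (\<Sum>y\<in>?B. x y * real (rdist (edges G) u y))) \<le> 0"
      using qform_move[of x] q by simp
    \<comment> \<open>A second vertex of \<open>f\<close> lies outside the branch, so this factor
      can be cancelled.\<close>
    moreover have "(\<Sum>v\<in>verts G - ?B. x v) > 0"
    proof -
      obtain v where "v \<in> f" "v \<noteq> u" using not_single[OF f, of u] u by blast
      then have "v \<in> verts G - ?B" using f_B edge_in_V f by blast
      then show ?thesis using finite_V x(1) by (intro sum_pos) auto
    qed
    ultimately show "(\<Sum>y\<in>?B. x y * real (rdist (edges G) a y)) \<le> (\<Sum>y\<in>?B. x y * real (rdist (edges G) u y))"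
      by (simp add: mult_le_0_iff)
  qed (use x not_single in auto)
  show ?thesis
  proof (rule isomorphic_loose_path[OF G k])
    show "e = f \<or> e = g \<or> f = g"
      if "e \<in> edges G" "f \<in> edges G" "g \<in> edges G" "v \<in> e" "v \<in> f" "v \<in> g" for v e f g
      using no_three_edges_at_vertex that by metis
    show "pendant (edges G) u \<or> pendant (edges G) v \<or> pendant (edges G) w"
      if e: "e \<in> edges G" "u \<in> e" "v \<in> e" "w \<in> e" "u \<noteq> v" "u \<noteq> w" "v \<noteq> w" for e u v w
    proof (rule ccontr)
      have "\<exists>g\<in>edges G. g \<noteq> e \<and> z \<in> g" if "\<not> pendant (edges G) z" for z
        using that unfolding pendant_def by metis
      moreover assume "\<not> ?thesis"
      ultimately show False using no_three_branches[OF e] by metis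
    qed
  qed
qed

theorem theorem4p2:
  fixes T :: "'a hypergraph" and n k :: nat
  assumes "k \<ge> 2"
    and "hypertree T" and "uniform k T"
    and "card (verts T) = n"
    and "(real n - 1) / (real k - 1) \<ge> 1"
  shows "dist_spectral_radius T \<le> dist_spectral_radius (loose_path n k) \<and>
    (dist_spectral_radius T = dist_spectral_radius (loose_path n k) \<longleftrightarrow>
       isomorphic T (loose_path n k))"
proof -
  have "real k - 1 \<le> real n - 1" using assms(1,5) by (simp add: le_divide_eq)
  then have card: "card (verts T) \<ge> 2" using assms(1,4) by simp
  let ?G = "\<lambda>F. \<lparr>verts = verts T, edges = F\<rparr>"
  let ?\<rho> = "\<lambda>F. dist_spectral_radius (?G F)"
  \<comment> \<open>With the vertex set fixed there are finitely many competitors, so a maximiser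
    \<open>F\<close> exists; it is a loose path, which identifies the maximum.\<close>
  define S where "S = {F. hypertree (?G F) \<and> uniform k (?G F)}"
  have "finite (verts T)" using assms(2) by (simp add: hypertree_def hypergraph_def)
  moreover have "S \<subseteq> Pow (Pow (verts T))"
    by (auto simp: S_def hypertree_def hypergraph_def)
  ultimately have fin: "finite S" by (meson finite_Pow_iff finite_subset)
  have eq: "?G (edges T) = T" by simp
  have T: "edges T \<in> S" using assms unfolding S_def mem_Collect_eq eq by blast
  have "Max (?\<rho> ` S) \<in> ?\<rho> ` S" using fin T by (intro Max_in) auto
  then obtain F where F: "F \<in> S" "Max (?\<rho> ` S) = ?\<rho> F" by blast
  have max: "?\<rho> F' \<le> ?\<rho> F" if "F' \<in> S" for F'
    using fin that F(2) Max_ge[of "?\<rho> ` S" "?\<rho> F'"] by simp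
  have "isomorphic (?G F) (loose_path (card (verts (?G F))) k)"
    using F(1) assms(1) card max by (intro maximal_isomorphic_loose_path) (auto simp: S_def)
  then have P: "dist_spectral_radius (loose_path n k) = ?\<rho> F"
    using F(1) card assms(4) by (intro dist_spectral_radius_isomorphic) (auto simp: S_def)
  have le: "dist_spectral_radius T \<le> ?\<rho> F" using max[OF T] unfolding eq .
  \<comment> \<open>With equality \<open>T\<close> is itself a maximiser, so the same
    characterisation applies to it.\<close>
  moreover have "isomorphic T (loose_path n k)" if "dist_spectral_radius T = ?\<rho> F"
    using maximal_isomorphic_loose_path[OF assms(2,3,1) card] max that assms(4) by (simp add: S_def)
  moreover have "dist_spectral_radius T = ?\<rho> F" if "isomorphic T (loose_path n k)"
    using dist_spectral_radius_isomorphic[OF assms(2) card that] P by simp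
  ultimately show ?thesis unfolding P by blast
qed

end
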